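(* Consider the random Dirichlet series $f(z)=a_1+\frac{a_2}{2^z}+\frac{a_3}{3^z}+\cdots$, where the $a_k$ are independent complex standard normal random variables; it converges with probability one for $\mathrm{Re}(z)>1/2$. Then for $1/2<x_1<x_2$ and $y_1<y_2$, the expected number of zeros of $f$ in the rectangle $x_1<\mathrm{Re}(z)<x_2$, $y_1<\mathrm{Im}(z)<y_2$ is $$\frac{1}{2\pi}\left(\frac{\zeta'(2x_2)}{\zeta(2x_2)}-\frac{\zeta'(2x_1)}{\zeta(2x_1)}\right)(y_2-y_1).$$ In particular, the density of zeros becomes infinite as one approaches the line $\{z:\mathrm{Re}(z)=1/2\}$ from the right.
   Context: $\zeta$ is the Riemann zeta function. A complex standard normal random variable has independent real and imaginary parts that are identically distributed mean-zero normal variables (the common variance does not affect the zero set). *)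

theory Defs
  imports "HOL-Probability.Probability"
begin

text \<open>Riemann zeta function on real arguments s > 1 (the only arguments needed),
  given by its defining Dirichlet series.\<close>
definition riemann_zeta :: "real \<Rightarrow> real" where
  "riemann_zeta s = (\<Sum>n. 1 / real (Suc n) powr s)"

definition complex_normal :: "'a measure \<Rightarrow> real \<Rightarrow> ('a \<Rightarrow> complex) \<Rightarrow> bool" where
  "complex_normal M \<sigma> X \<longleftrightarrow>
     distributed M (lborel \<Otimes>\<^sub>M lborel) (\<lambda>\<omega>. (Re (X \<omega>), Im (X \<omega>)))
       (\<lambda>(x, y). ennreal (normal_density 0 \<sigma> x * normal_density 0 \<sigma> y))"

definition zero_count :: "(complex \<Rightarrow> complex) \<Rightarrow> complex set \<Rightarrow> ennreal" where
  "zero_count g S = emeasure (count_space UNIV) {z \<in> S. g z = 0}"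

definition open_rect :: "real \<Rightarrow> real \<Rightarrow> real \<Rightarrow> real \<Rightarrow> complex set" where
  "open_rect x1 x2 y1 y2 = {z. x1 < Re z \<and> Re z < x2 \<and> y1 < Im z \<and> Im z < y2}"

definition rand_dirichlet :: "(nat \<Rightarrow> 'a \<Rightarrow> complex) \<Rightarrow> 'a \<Rightarrow> complex \<Rightarrow> complex" where
  "rand_dirichlet a \<omega> z = (\<Sum>k. a k \<omega> / of_nat (Suc k) powr z)"

end

theory Submission
  imports Defs "HOL-Complex_Analysis.Complex_Analysis"
begin

text \<open>By the argument principle the number of zeros in a rectangle is the integral of $f'/f$ over its
  boundary, divided by $2\pi i$; so its expectation is the boundary integral of $E(f'/f)$. For fixed $z$
  the pair $(f(z), f'(z))$ is jointly Gaussian, and $f'(z) - c f(z)$ is independent of $f(z)$ for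
  $c = \zeta'(2 \mathrm{Re} z) / \zeta(2 \mathrm{Re} z)$; hence $E(f'/f) = c$. The horizontal sides of the rectangle
  cancel and the vertical ones give the formula.

  Everything else exploits that the constant coefficient $a_1$ (here \<open>a 0\<close>) is independent of the other ones.
  Conditionally on these, $f = a_1 + g$ with $g$ fixed: zeros on the boundary, or multiple zeros, force $-a_1$
  into a null set ($g$ of a null set, or the critical values of $g$), and $1/|f(z)|$ has a conditional
  expectation that is bounded uniformly in $g$. Almost sure convergence follows from Abel summation, since
  the partial sums of the coefficients are $O(n^{1/2 + \epsilon})$ by Markov's inequality for high moments
  and the Borel--Cantelli lemma.\<close>

section \<open>Dirichlet series with square-root cancellation\<close>

text \<open>The obstacle is the integrability of f'/f, on which every exchange of expectation and
  boundary integral rests. Cauchy-Schwarz is of no use: 1/|f|^2 has infinite mean, because 1/|z|^2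
  is not integrable near 0 in the plane, whereas 1/|z| is. The way out is that f' does not contain
  the coefficient \<open>a 0\<close>, since ln 1 = 0: given the other coefficients, f' is constant,
  and averaging 1/|f| over \<open>a 0\<close> alone costs a fixed factor. The resulting bound
  depends on Re z only and does not increase with it, so it serves a whole side of the rectangle.
  The constant c makes f' - c f orthogonal to f: up to the factor 2 \<sigma>^2, E(f' cnj f) is the
  sum of -ln n / n^(2 Re z), that is \<zeta>'(2 Re z), and E|f|^2 is \<zeta>(2 Re z). Convergence is
  reduced to one deterministic property of the coefficient sequence, \<open>sqrt_cancel\<close>, so
  that a single null set serves all z and sequences with a changed first coefficient are covered
  too.\<close>

definition dirichlet :: "(nat \<Rightarrow> complex) \<Rightarrow> complex \<Rightarrow> complex" where
  "dirichlet s z = (\<Sum>k. s k / of_nat (Suc k) powr z)"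

text \<open>Coefficients of the termwise derivative. Entry 0 is 0 because ln 1 = 0, so the
  derivative series is blind to \<open>s 0\<close>.\<close>

definition dlog :: "(nat \<Rightarrow> complex) \<Rightarrow> nat \<Rightarrow> complex" where
  "dlog s k = - (of_real (ln (real (Suc k))) * s k)"

text \<open>The exponents 1/2 + 1/m stand for 1/2 + \<epsilon>: countably many of them suffice, so
  the property can hold almost surely.\<close>

definition sqrt_cancel :: "(nat \<Rightarrow> complex) \<Rightarrow> bool" where
  "sqrt_cancel s \<longleftrightarrow>
     (\<forall>m>0. \<exists>C. \<forall>n. norm (\<Sum>k<n. s k) \<le> C * real n powr (1/2 + 1 / real m))"

text \<open>The boundary term carries \<open>c n\<close> instead of \<open>c (n - 1)\<close>, so n =
  0 is no special case.\<close>

lemma summation_by_parts: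
  fixes s c :: "nat \<Rightarrow> 'a::comm_ring_1"
  shows "(\<Sum>k<n. s k * c k) =
    (\<Sum>k<n. (\<Sum>j<Suc k. s j) * (c k - c (Suc k))) + (\<Sum>j<n. s j) * c n"
  by (induction n) (simp_all add: algebra_simps)

lemma norm_of_nat_powr: "n > 0 \<Longrightarrow> norm (of_nat n powr z :: complex) = real n powr Re z"
  by (simp add: norm_powr_real_powr)

text \<open>Mean value estimate on a segment of length 1, where the bound for the derivative -w
  x^(-w-1) is largest at the left end. The gain of one power of k over a single term is what Abel
  summation lives on.\<close>

lemma norm_powr_minus_diff_le:
  fixes w :: complex
  assumes "Re w > 0"
  shows "norm (of_nat (Suc k) powr (-w) - of_nat (Suc (Suc k)) powr (-w))
           \<le> norm w * real (Suc k) powr (- Re w - 1)"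
proof -
  let ?S = "closed_segment (complex_of_real (Suc k)) (complex_of_real (Suc (Suc k)))"
  have Sre: "\<exists>t. x = complex_of_real t \<and> t \<ge> Suc k" if "x \<in> ?S" for x
  proof -
    have "x \<in> complex_of_real ` closed_segment (real (Suc k)) (real (Suc (Suc k)))"
      using that by (simp only: closed_segment_of_real)
    thus ?thesis by (auto simp: closed_segment_eq_real_ivl)
  qed
  have "norm (complex_of_real (Suc k) powr (-w) - complex_of_real (Suc (Suc k)) powr (-w))
     \<le> norm w * real (Suc k) powr (- Re w - 1) * norm (complex_of_real (Suc k) - complex_of_real (Suc (Suc k)))"
  proof (rule field_differentiable_bound[where S = ?S and f' = "\<lambda>x. - w * x powr (-w - 1)"])
    fix x assume x: "x \<in> ?S"
    then obtain t where t: "x = complex_of_real t" "t \<ge> Suc k" using Sre by blast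
    then have "t > 0" by simp
    then have "x \<notin> \<real>\<^sub>\<le>\<^sub>0" using t by (simp add: complex_nonpos_Reals_iff)
    then show "((\<lambda>x. x powr (-w)) has_field_derivative - w * x powr (-w - 1)) (at x within ?S)"
      by (auto intro!: derivative_eq_intros)
    have "norm (x powr (-w-1)) = t powr (- Re w - 1)"
      using t \<open>t > 0\<close> by (simp add: norm_powr_real_powr)
    also have "\<dots> \<le> real (Suc k) powr (- Re w - 1)"
      using t assms by (intro powr_mono2') auto
    finally show "norm (- w * x powr (-w - 1)) \<le> norm w * real (Suc k) powr (- Re w - 1)"
      by (simp add: norm_mult mult_left_mono)
  qed auto
  thus ?thesis by (simp add: norm_divide)
qed

text \<open>After Abel summation the k-th term is of order k^(1/2 + 1/m) k^(-Re w - 1), summable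
  once Re w > 1/2 + 1/m; the boundary term is of order n^(1/2 + 1/m - Re w). Both estimates are
  uniform on a small ball, which is what termwise differentiation asks for.\<close>

lemma dirichlet_uniform_limit:
  assumes s: "sqrt_cancel s" and z: "Re z > 1/2"
  shows "\<exists>d>0. cball z d \<subseteq> {w. Re w > 1/2} \<and>
    uniform_limit (cball z d) (\<lambda>n w. \<Sum>k<n. s k / of_nat (Suc k) powr w) (dirichlet s) sequentially"
proof -
  \<comment> \<open>Half the distance to the line Re z = 1/2, so that Re w \<ge> 1/2 + d on the
    ball. With 1/m < d/2 the exponents below stay at most -1 - d/2 and -d/2.\<close>
  define d where "d = (Re z - 1/2) / 2"
  have d: "d > 0" using z by (simp add: d_def)
  obtain m :: nat where m: "m > 0" "1 / real m < d / 2"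
    using d by (metis nat_approx_posE half_gt_zero less_imp_of_nat_less of_nat_0_less_iff zero_less_Suc)
  from s m obtain C where C: "\<And>n. norm (\<Sum>k<n. s k) \<le> C * real n powr (1/2 + 1 / real m)"
    unfolding sqrt_cancel_def by blast
  have C0: "C \<ge> 0" using C[of 1] norm_ge_zero[of "s 0"] by (simp, linarith)
  have re: "Re w \<ge> 1/2 + d" and nw: "norm w \<le> norm z + d" if "w \<in> cball z d" for w
  proof -
    have "norm (z - w) \<le> d" using that by (simp add: dist_norm)
    moreover have "\<bar>Re (z - w)\<bar> \<le> norm (z - w)" by (rule abs_Re_le_cmod)
    moreover have "norm w \<le> norm z + norm (z - w)"
      using norm_triangle_ineq4[of z "z - w"] by simp
    ultimately have "\<bar>Re (z - w)\<bar> \<le> d" "norm w \<le> norm z + d" by linarith+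
    moreover have "Re z = 1/2 + 2 * d" by (simp add: d_def field_simps)
    ultimately show "Re w \<ge> 1/2 + d" "norm w \<le> norm z + d"
      unfolding minus_complex.sel by linarith+
  qed
  define A where "A n = (\<Sum>j<n. s j)" for n
  define c where "c w k = (of_nat (Suc k) :: complex) powr (-w)" for w k
  define F where "F w = (\<Sum>k. A (Suc k) * (c w k - c w (Suc k)))" for w
  have eq: "(\<Sum>k<n. s k / of_nat (Suc k) powr w) =
      (\<Sum>k<n. A (Suc k) * (c w k - c w (Suc k))) + A n * c w n" for n w
    using summation_by_parts[of s "c w" n]
    by (simp add: A_def c_def powr_minus field_class.field_divide_inverse)
  have 1: "uniform_limit (cball z d) (\<lambda>n w. \<Sum>k<n. A (Suc k) * (c w k - c w (Suc k))) F sequentially"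
    unfolding F_def
  proof (rule Weierstrass_m_test)
    fix k w assume w: "w \<in> cball z d"
    have "norm (A (Suc k) * (c w k - c w (Suc k))) \<le>
        (C * real (Suc k) powr (1/2 + 1 / real m)) * (norm w * real (Suc k) powr (- Re w - 1))"
      unfolding norm_mult A_def c_def
      using re[OF w] d by (intro mult_mono C norm_powr_minus_diff_le) (auto simp: C0)
    also have "\<dots> \<le> (C * real (Suc k) powr (1/2 + 1 / real m)) * ((norm z + d) * real (Suc k) powr (- 3/2 - d))"
      using re[OF w] nw[OF w] C0 d
      by (intro mult_left_mono mult_mono powr_mono) auto
    also have "\<dots> = (C * (norm z + d)) * (real (Suc k) powr (-1 + (1 / real m - d)))"
      by (simp add: powr_add[symmetric] mult_ac)
    also have "\<dots> \<le> (C * (norm z + d)) * (real (Suc k) powr (-1 - d/2))"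
      using m C0 d by (intro mult_left_mono powr_mono) (auto intro: add_nonneg_nonneg)
    finally show "norm (A (Suc k) * (c w k - c w (Suc k))) \<le> (C * (norm z + d)) * (real (Suc k) powr (-1 - d/2))" .
  next
    have "summable (\<lambda>k. real k powr (-1 - d/2))"
      using d by (simp add: summable_real_powr_iff)
    then have "summable (\<lambda>k. real (Suc k) powr (-1 - d/2))" by (subst summable_Suc_iff)
    then show "summable (\<lambda>k. (C * (norm z + d)) * real (Suc k) powr (-1 - d/2))"
      by (rule summable_mult)
  qed
  have 2: "uniform_limit (cball z d) (\<lambda>n w. A n * c w n) (\<lambda>_. 0) sequentially"
  proof (rule uniform_limitI)
    fix e :: real assume e: "e > 0"
    have "((\<lambda>n. C * real n powr (- d/2)) \<longlongrightarrow> C * 0) sequentially"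
      using d by (intro tendsto_mult tendsto_const)
        (auto intro!: tendsto_neg_powr filterlim_real_sequentially)
    then have "\<forall>\<^sub>F n in sequentially. C * real n powr (- d/2) < e"
      using e by (auto intro: order_tendstoD)
    moreover have "\<forall>\<^sub>F n in sequentially. n > (0::nat)" by (rule eventually_gt_at_top)
    ultimately show "\<forall>\<^sub>F n in sequentially. \<forall>w\<in>cball z d. dist (A n * c w n) 0 < e"
    proof eventually_elim
      case (elim n)
      show ?case
      proof
        fix w assume w: "w \<in> cball z d"
        have "norm (A n * c w n) \<le> (C * real n powr (1/2 + 1 / real m)) * real (Suc n) powr (- Re w)"
          unfolding norm_mult A_def c_def using norm_of_nat_powr[of "Suc n" "-w"]
          by (intro mult_mono C) (auto simp: C0)
        also have "\<dots> \<le> (C * real n powr (1/2 + 1 / real m)) * real n powr (- Re w)"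
          using re[OF w] d elim C0 by (intro mult_left_mono powr_mono2') auto
        also have "\<dots> = C * real n powr (1/2 + 1/real m - Re w)"
          by (simp add: powr_add[symmetric] mult_ac)
        also have "\<dots> \<le> C * real n powr (-d/2)"
          using re[OF w] m elim C0 by (intro mult_left_mono powr_mono) auto
        finally show "dist (A n * c w n) 0 < e" using elim by simp
      qed
    qed
  qed
  have 3: "uniform_limit (cball z d) (\<lambda>n w. \<Sum>k<n. s k / of_nat (Suc k) powr w) F sequentially"
    using uniform_limit_add[OF 1 2] unfolding eq by simp
  have "F w = dirichlet s w" if "w \<in> cball z d" for w
    using tendsto_uniform_limitI[OF 3 that] unfolding dirichlet_def
    by (metis sums_def sums_unique)
  then have "uniform_limit (cball z d) (\<lambda>n w. \<Sum>k<n. s k / of_nat (Suc k) powr w) (dirichlet s) sequentially"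
    by (rule iffD1[OF uniform_limit_cong'[OF refl], OF _ 3])
  moreover have "cball z d \<subseteq> {w. Re w > 1/2}" using re d by fastforce
  ultimately show ?thesis using d by blast
qed

lemma has_field_derivative_dirichlet_term:
  fixes s w :: complex
  shows "((\<lambda>w. s / of_nat (Suc k) powr w) has_field_derivative
     (- (of_real (ln (real (Suc k))) * s)) / of_nat (Suc k) powr w) (at w)"
proof -
  have ln: "ln (of_nat (Suc k)) = complex_of_real (ln (real (Suc k)))"
    by (metis Ln_of_real of_real_of_nat_eq of_nat_0_less_iff zero_less_Suc)
  have eq: "x / of_nat (Suc k) powr w = x * exp (- (w * ln (of_nat (Suc k))))" for x w :: complex
    using of_nat_neq_0[of k, where 'a = complex]
    by (simp add: powr_def exp_minus field_simps del: of_nat_Suc)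
  have "((\<lambda>w. s * exp (- (w * ln (of_nat (Suc k))))) has_field_derivative
     s * (exp (- (w * ln (of_nat (Suc k)))) * - ln (of_nat (Suc k)))) (at w)"
    by (auto intro!: derivative_eq_intros)
  then show ?thesis unfolding eq ln by (simp add: mult_ac)
qed

text \<open>Weierstrass: a locally uniform limit of holomorphic partial sums may be differentiated
  term by term. The convergence of the derivative series comes from the same theorem, not from an
  estimate of \<open>dlog s\<close>.\<close>

lemma sqrt_cancel_dirichlet:
  assumes s: "sqrt_cancel s" and z: "Re z > 1/2"
  shows dirichlet_sums: "(\<lambda>k. s k / of_nat (Suc k) powr z) sums dirichlet s z"
    and dirichlet_dlog_sums: "(\<lambda>k. dlog s k / of_nat (Suc k) powr z) sums dirichlet (dlog s) z"
    and has_field_derivative_dirichlet: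
      "(dirichlet s has_field_derivative dirichlet (dlog s) z) (at z)"
proof -
  have op: "open {w. Re w > 1/2}" by (rule open_halfspace_Re_gt)
  obtain d where "d > 0" and u: "uniform_limit (cball z d)
       (\<lambda>n w. \<Sum>k<n. s k / of_nat (Suc k) powr w) (dirichlet s) sequentially"
    using dirichlet_uniform_limit[OF s z] by blast
  show "(\<lambda>k. s k / of_nat (Suc k) powr z) sums dirichlet s z"
    unfolding sums_def using tendsto_uniform_limitI[OF u, of z] \<open>d > 0\<close> by simp
  have "\<exists>g'. \<forall>x\<in>{w. Re w > 1/2}. (dirichlet s has_field_derivative g' x) (at x) \<and>
     (\<lambda>n. \<Sum>k<n. dlog s k / of_nat (Suc k) powr x) \<longlonglongrightarrow> g' x"
  proof (rule has_complex_derivative_uniform_sequence[OF op])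
    fix n x
    show "((\<lambda>w. \<Sum>k<n. s k / of_nat (Suc k) powr w) has_field_derivative
       (\<Sum>k<n. dlog s k / of_nat (Suc k) powr x)) (at x)"
      unfolding dlog_def by (intro DERIV_sum has_field_derivative_dirichlet_term)
  next
    fix x assume "x \<in> {w. Re w > 1/2}"
    then show "\<exists>d>0. cball x d \<subseteq> {w. 1 / 2 < Re w} \<and>
        uniform_limit (cball x d) (\<lambda>n w. \<Sum>k<n. s k / of_nat (Suc k) powr w) (dirichlet s) sequentially"
      using dirichlet_uniform_limit[OF s] by simp
  qed
  then obtain g' where g': "(dirichlet s has_field_derivative g' z) (at z)"
     "(\<lambda>k. dlog s k / of_nat (Suc k) powr z) sums g' z"
    using z unfolding sums_def by blast
  then have "g' z = dirichlet (dlog s) z"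
    unfolding dirichlet_def by (metis sums_unique)
  with g' show "(\<lambda>k. dlog s k / of_nat (Suc k) powr z) sums dirichlet (dlog s) z"
    "(dirichlet s has_field_derivative dirichlet (dlog s) z) (at z)" by simp_all
qed

lemma holomorphic_dirichlet:
  "sqrt_cancel s \<Longrightarrow> dirichlet s holomorphic_on {z. Re z > 1/2}"
  using has_field_derivative_dirichlet
  by (auto simp: holomorphic_on_def field_differentiable_def intro: has_field_derivative_at_within)

text \<open>Every nonempty partial sum moves by the same amount \<open>c - s 0\<close>, which the
  constant absorbs because n^(1/2 + 1/m) \<ge> 1. Resampling the first coefficient thus stays within
  the sequences treated here.\<close>

lemma sqrt_cancel_upd0:
  assumes "sqrt_cancel s"
  shows "sqrt_cancel (s(0 := c))"
  unfolding sqrt_cancel_def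
proof (intro allI impI)
  fix m :: nat assume "m > 0"
  then obtain C where C: "\<And>n. norm (\<Sum>k<n. s k) \<le> C * real n powr (1/2 + 1 / real m)"
    using assms unfolding sqrt_cancel_def by blast
  show "\<exists>C. \<forall>n. norm (\<Sum>k<n. (s(0 := c)) k) \<le> C * real n powr (1/2 + 1 / real m)"
  proof (intro exI allI)
    fix n :: nat
    show "norm (\<Sum>k<n. (s(0 := c)) k) \<le> (C + norm (c - s 0)) * real n powr (1/2 + 1 / real m)"
    proof (cases n)
      case (Suc n')
      have "(\<Sum>k<n. (s(0 := c)) k) = (\<Sum>k<n. s k) + (c - s 0)"
        unfolding Suc by (simp only: lessThan_Suc_eq_insert_0 ) (simp add: sum.reindex)
      then have "norm (\<Sum>k<n. (s(0 := c)) k) \<le> norm (\<Sum>k<n. s k) + norm (c - s 0)"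
        by (metis norm_triangle_ineq)
      also have "\<dots> \<le> C * real n powr (1/2 + 1 / real m) + norm (c - s 0) * real n powr (1/2 + 1 / real m)"
      proof (rule add_mono[OF C])
        have "1 \<le> real n powr (1/2 + 1 / real m)"
          using Suc by (intro ge_one_powr_ge_zero) auto
        then show "norm (c - s 0) \<le> norm (c - s 0) * real n powr (1/2 + 1 / real m)"
          using mult_left_mono[of 1 _ "norm (c - s 0)"] by simp
      qed
      finally show ?thesis by (simp only: distrib_right)
    next
      case 0
      then show ?thesis by simp
    qed
  qed
qed

section \<open>Counting simple zeros; the zeta function\<close>

text \<open>The argument principle is applied on the larger open box, whose closure is a compact
  part of S and so contains finitely many zeros. Those outside the inner rectangle have winding
  number 0; those inside have winding number 1 and, being simple, order 1.\<close>

lemma count_simple_zeros_rectpath: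
  assumes f: "f holomorphic_on S" and S: "open S" "connected S"
    and K: "cbox a' b' \<subseteq> S" and sub: "cbox a b \<subseteq> box a' b'"
    and ab: "Re a < Re b" "Im a < Im b"
    and bd: "\<And>z. z \<in> cbox a b - box a b \<Longrightarrow> f z \<noteq> 0"
    and simple: "\<And>z. z \<in> box a b \<Longrightarrow> f z = 0 \<Longrightarrow> deriv f z \<noteq> 0"
  shows "finite {z \<in> box a b. f z = 0}"
    and "contour_integral (rectpath a b) (\<lambda>z. deriv f z / f z) =
           2 * pi * \<i> * card {z \<in> box a b. f z = 0}"
proof -
  have bS: "box a' b' \<subseteq> S" using K box_subset_cbox by blast
  have hol: "f holomorphic_on box a' b'" using f bS holomorphic_on_subset by blast
  have ain: "a \<in> cbox a b" "a \<notin> box a b"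
    using ab by (auto simp: in_cbox_complex_iff in_box_complex_iff)
  \<comment> \<open>A constant f cannot be 0, because the corner a lies on the boundary, where f
    does not vanish.\<close>
  have fin: "finite {z \<in> cbox a' b'. f z = 0}"
  proof (cases "f constant_on S")
    case True
    then obtain c where c: "\<And>z. z \<in> S \<Longrightarrow> f z = c" by (auto simp: constant_on_def)
    have "a \<in> S" using ain sub bS by blast
    then have "c \<noteq> 0" using bd[of a] ain c[of a] by auto
    then have "{z \<in> cbox a' b'. f z = 0} = {}" using c K by auto
    then show ?thesis by (simp only: finite.emptyI)
  next
    case False
    show ?thesis by (rule holomorphic_compact_finite_zeros[OF f S compact_cbox K False])
  qed
  let ?Z = "{z \<in> box a b. f z = 0}" and ?P = "{w \<in> box a' b'. f w = 0 \<or> w \<in> {}}"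
  have Z_sub: "?Z \<subseteq> ?P" using sub box_subset_cbox[of a b] by auto
  have finP: "finite ?P" by (rule finite_subset[OF _ fin]) (use box_subset_cbox in auto)
  show "finite ?Z" using finP Z_sub finite_subset by blast
  have pim: "path_image (rectpath a b) = cbox a b - box a b"
    using ab by (simp add: path_image_rectpath_cbox_minus_box)
  have "contour_integral (rectpath a b) (\<lambda>x. deriv f x * 1 / f x) = 2 * pi * \<i> *
          (\<Sum>p\<in>?P. winding_number (rectpath a b) p * 1 * zorder f p)"
  proof (rule argument_principle)
    show "path_image (rectpath a b) \<subseteq> box a' b' - ?P" using pim sub bd by auto
    show "\<forall>z. z \<notin> box a' b' \<longrightarrow> winding_number (rectpath a b) z = 0"
      using ab sub by (auto intro!: winding_number_rectpath_outside)
  qed (use hol finP in \<open>auto intro: convex_connected convex_box\<close>)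
  also have "(\<Sum>p\<in>?P. winding_number (rectpath a b) p * 1 * zorder f p) = (\<Sum>p\<in>?Z. 1)"
  proof (rule sum.mono_neutral_cong_right[OF finP Z_sub])
    show "\<forall>p\<in>?P - ?Z. winding_number (rectpath a b) p * 1 * zorder f p = 0"
    proof
      fix p assume "p \<in> ?P - ?Z"
      then have "p \<notin> cbox a b" using bd by auto
      then show "winding_number (rectpath a b) p * 1 * zorder f p = 0"
        using ab winding_number_rectpath_outside[of a b p] by simp
    qed
  next
    fix p assume p: "p \<in> ?Z"
    then have "p \<in> box a' b'" using Z_sub by auto
    then have "zorder f p = 1"
      using p simple[of p] hol by (intro zorder_zero_eqI[of f "box a' b'" p 1]) auto
    then show "winding_number (rectpath a b) p * 1 * zorder f p = 1"
      using p by (simp add: winding_number_rectpath)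
  qed
  finally show "contour_integral (rectpath a b) (\<lambda>z. deriv f z / f z) = 2 * pi * \<i> * card ?Z"
    by simp
qed

section \<open>The zeta function and its logarithmic derivative to the right of 1\<close>

lemma summable_ln_powr:
  assumes "c > 1"
  shows "summable (\<lambda>n. ln (real (Suc n)) ^ p / real (Suc n) powr c)"
proof -
  \<comment> \<open>Any small power beats the logarithm: this e gives e p \<le> (c - 1) / 2, which
    keeps e p - c below -1; the + 1 avoids division by 0 at p = 0. The cases p = 0, 1, 2 serve
    \<zeta>, its derivative and the variance of f'.\<close>
  define e where "e = (c - 1) / (2 * (real p + 1))"
  have e: "e > 0" using assms by (simp add: e_def)
  have "e * p \<le> (c - 1) / 2" using assms by (simp add: e_def field_simps)
  then have ec: "e * p - c < -1" using assms by (simp add: field_simps)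
  have "summable (\<lambda>k. real k powr (e * p - c))"
    using ec by (simp add: summable_real_powr_iff)
  then have "summable (\<lambda>k. real (Suc k) powr (e * p - c))" by (subst summable_Suc_iff)
  then have "summable (\<lambda>k. (1/e) ^ p * real (Suc k) powr (e * p - c))" by (rule summable_mult)
  then show ?thesis
  proof (rule summable_comparison_test'[where N = 0])
    fix n :: nat
    have "ln (real (Suc n)) \<le> real (Suc n) powr e / e" using e by (intro ln_powr_bound) auto
    then have "ln (real (Suc n)) ^ p \<le> (real (Suc n) powr e / e) ^ p"
      by (intro power_mono) auto
    also have "\<dots> = (1/e) ^ p * real (Suc n) powr (e * p)"
      by (simp add: power_divide powr_powr[symmetric] powr_realpow[symmetric])
    finally have "ln (real (Suc n)) ^ p / real (Suc n) powr c \<le>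
        (1/e) ^ p * real (Suc n) powr (e * p) / real (Suc n) powr c"
      by (intro divide_right_mono) auto
    then show "norm (ln (real (Suc n)) ^ p / real (Suc n) powr c) \<le> (1/e) ^ p * real (Suc n) powr (e * p - c)"
      by (simp add: powr_diff)
  qed
qed

lemma summable_zeta: "s > 1 \<Longrightarrow> summable (\<lambda>n. 1 / real (Suc n) powr s)"
  using summable_ln_powr[of s 0] by simp

lemma riemann_zeta_ge_1:
  assumes "s > 1" shows "riemann_zeta s \<ge> 1"
  using sum_le_suminf[OF summable_zeta[OF assms], of "{..<1}"]
  by (simp add: riemann_zeta_def)

lemma deriv_riemann_zeta:
  assumes s: "s > 1"
  shows "deriv riemann_zeta s = - (\<Sum>n. ln (real (Suc n)) / real (Suc n) powr s)"
proof -
  \<comment> \<open>A point between 1 and s: the terms at c dominate the differentiated series on a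
    neighbourhood of s.\<close>
  define c where "c = (1 + s) / 2"
  have c: "c > 1" "c < s" using s by (auto simp: c_def)
  have "((\<lambda>x. \<Sum>n. 1 / real (Suc n) powr x) has_field_derivative
      (\<Sum>n. - (ln (real (Suc n)) / real (Suc n) powr s))) (at s)"
  proof (rule has_field_derivative_series'(2)[where S = "{c<..}" and x0 = s])
    fix n x assume "x \<in> {c<..}"
    have eq: "1 / real (Suc n) powr x = exp (- (x * ln (real (Suc n))))" for x
      by (simp add: powr_def exp_minus field_simps)
    have "((\<lambda>x. exp (- (x * ln (real (Suc n))))) has_field_derivative
       exp (- (x * ln (real (Suc n)))) * - ln (real (Suc n))) (at x within {c<..})"
      by (auto intro!: derivative_eq_intros)
    then show "((\<lambda>x. 1 / real (Suc n) powr x) has_field_derivative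
       - (ln (real (Suc n)) / real (Suc n) powr x)) (at x within {c<..})"
      unfolding eq using eq[of x] by (simp add: mult_ac powr_def exp_minus field_simps)
  next
    show "uniformly_convergent_on {c<..} (\<lambda>n x. \<Sum>i<n. - (ln (real (Suc i)) / real (Suc i) powr x))"
    proof (rule Weierstrass_m_test')
      show "summable (\<lambda>n. ln (real (Suc n)) / real (Suc n) powr c)"
        using summable_ln_powr[OF c(1), of 1] by simp
      fix n x assume "x \<in> {c<..}"
      then show "norm (- (ln (real (Suc n)) / real (Suc n) powr x)) \<le> ln (real (Suc n)) / real (Suc n) powr c"
        by (auto intro!: divide_left_mono powr_mono simp del: of_nat_Suc)
    qed
  qed (use c summable_zeta[OF s] in \<open>auto simp: interior_open\<close>)
  then show ?thesis
    unfolding riemann_zeta_def[abs_def]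
    by (simp add: DERIV_imp_deriv suminf_minus summable_ln_powr[OF s, of 1, simplified])
qed

text \<open>-\<zeta>'/\<zeta> at s is the mean of ln n under the weights n^(-s) / \<zeta>(s). As s
  decreases to 1 the total mass \<zeta>(s) grows without bound, by divergence of the harmonic
  series, so the first N terms lose all weight and the mean exceeds any bound. This is an elementary
  substitute for the pole of \<zeta>.\<close>

lemma filterlim_log_deriv_zeta:
  "filterlim (\<lambda>s. deriv riemann_zeta s / riemann_zeta s) at_bot (at_right 1)"
proof (rule filterlim_at_bot_lt[where c = 0, THEN iffD2], intro allI impI)
  have right: "eventually (\<lambda>s. s > (1::real)) (at_right 1)"
    by (simp add: eventually_at_right_less)
  \<comment> \<open>A partial sum that exceeds B at s = 1 is continuous in s, so it exceeds B nearby
    and bounds \<zeta>(s) from below.\<close>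
  have big: "eventually (\<lambda>s. riemann_zeta s \<ge> B) (at_right 1)" for B
  proof -
    have "\<not> summable (\<lambda>n. 1 / real (Suc n))"
      using not_summable_harmonic[where 'a = real] summable_Suc_iff[of "\<lambda>n. inverse (real n)"]
      by (simp add: inverse_eq_divide del: of_nat_Suc)
    moreover have "summable (\<lambda>n. 1 / real (Suc n))" if "\<And>N. (\<Sum>n<N. 1 / real (Suc n)) \<le> B"
      by (rule summableI_nonneg_bounded[OF _ that]) simp
    ultimately obtain N where N: "(\<Sum>n<N. 1 / real (Suc n)) > B"
      by (meson not_le)
    have "((\<lambda>s. \<Sum>n<N. 1 / real (Suc n) powr s) \<longlongrightarrow> (\<Sum>n<N. 1 / real (Suc n) powr 1)) (at_right 1)"
      by (intro tendsto_intros) auto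
    then have "eventually (\<lambda>s. (\<Sum>n<N. 1 / real (Suc n) powr s) > B) (at_right 1)"
      using N by (intro order_tendstoD(1)) auto
    then show ?thesis using right
    proof eventually_elim
      case (elim s)
      have "(\<Sum>n<N. 1 / real (Suc n) powr s) \<le> riemann_zeta s"
        unfolding riemann_zeta_def using elim by (intro sum_le_suminf summable_zeta) auto
      then show ?case using elim by simp
    qed
  qed
  fix Z :: real assume "Z < 0"
  define K where "K = - Z"
  have K: "K > 0" using \<open>Z < 0\<close> by (simp add: K_def)
  \<comment> \<open>After the first N terms every logarithm is at least 2 K. With \<zeta>(s) \<ge> 2
    N those first N terms, each at most 1, hold at most half the mass, so the mean of the logarithms
    is at least K.\<close>
  obtain N :: nat where N: "real N \<ge> exp (2 * K)" using real_arch_simple by blast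
  from big[of "2 * real N"] right
  show "eventually (\<lambda>s. deriv riemann_zeta s / riemann_zeta s \<le> Z) (at_right 1)"
  proof eventually_elim
    case (elim s)
    let ?t = "\<lambda>n. 1 / real (Suc n) powr s"
    have "(\<Sum>n<N. ?t n) \<le> (\<Sum>n<N. 1)"
      using elim by (intro sum_mono) (auto intro!: divide_le_eq_1[THEN iffD2] ge_one_powr_ge_zero)
    then have "riemann_zeta s - real N \<le> riemann_zeta s - (\<Sum>n<N. ?t n)" by simp
    also have "\<dots> = (\<Sum>n. ?t (n + N))"
      unfolding riemann_zeta_def using elim
      by (subst suminf_minus_initial_segment[OF summable_zeta]) auto
    finally have "2 * K * (riemann_zeta s - real N) \<le> 2 * K * (\<Sum>n. ?t (n + N))"
      using K by (intro mult_left_mono) auto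
    also have "\<dots> = (\<Sum>n. 2 * K * ?t (n + N))"
      using elim by (intro suminf_mult[symmetric] summable_ignore_initial_segment summable_zeta) auto
    also have "\<dots> \<le> (\<Sum>n. ln (real (Suc (n + N))) / real (Suc (n + N)) powr s)"
    proof (rule suminf_le)
      fix n
      have "exp (2 * K) \<le> real (Suc (n + N))" using N by simp
      then have "2 * K \<le> ln (real (Suc (n + N)))" by (subst ln_ge_iff) auto
      then show "2 * K * ?t (n + N) \<le> ln (real (Suc (n + N))) / real (Suc (n + N)) powr s"
        using divide_right_mono[of "2 * K" "ln (real (Suc (n + N)))" "real (Suc (n + N)) powr s"] by simp
    next
      show "summable (\<lambda>n. 2 * K * ?t (n + N))"
        using elim by (intro summable_mult summable_ignore_initial_segment summable_zeta) auto
      show "summable (\<lambda>n. ln (real (Suc (n + N))) / real (Suc (n + N)) powr s)"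
        using elim summable_ignore_initial_segment[OF summable_ln_powr[of s 1], of N] by simp
    qed
    also have "\<dots> = (\<Sum>n. ln (real (Suc n)) / real (Suc n) powr s) - (\<Sum>n<N. ln (real (Suc n)) / real (Suc n) powr s)"
      using elim summable_ln_powr[of s 1] by (intro suminf_minus_initial_segment) simp
    also have "\<dots> \<le> - deriv riemann_zeta s"
      using elim by (simp add: deriv_riemann_zeta sum_nonneg)
    finally have "2 * K * (riemann_zeta s - real N) \<le> - deriv riemann_zeta s" .
    moreover have "K * (2 * real N) \<le> K * riemann_zeta s"
      using elim K by (intro mult_left_mono) auto
    ultimately have "deriv riemann_zeta s \<le> Z * riemann_zeta s"
      by (simp add: K_def algebra_simps)
    then show ?case using riemann_zeta_ge_1[of s] elim by (simp add: divide_le_eq)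
  qed
qed

section \<open>Complex Gaussian integrals\<close>

abbreviation ndist :: "real \<Rightarrow> real measure" where
  "ndist \<sigma> \<equiv> density lborel (\<lambda>x. ennreal (normal_density 0 \<sigma> x))"

text \<open>The law of one coefficient, encoded as the image of a product measure so that planar
  integrals split into real ones.\<close>

definition cgauss :: "real \<Rightarrow> complex measure" where
  "cgauss \<sigma> = distr (ndist \<sigma> \<Otimes>\<^sub>M ndist \<sigma>) borel (\<lambda>(x, y). Complex x y)"

lemma borel_measurable_Complex [measurable (raw)]:
  assumes [measurable]: "f \<in> borel_measurable M" "g \<in> borel_measurable M"
  shows "(\<lambda>x. Complex (f x) (g x)) \<in> borel_measurable M"
  unfolding Complex_eq by measurable

lemma sets_cgauss [measurable_cong, simp]: "sets (cgauss \<sigma>) = sets borel"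
  by (simp add: cgauss_def)

lemma space_cgauss [simp]: "space (cgauss \<sigma>) = UNIV"
  by (simp add: cgauss_def)

context
  fixes \<sigma> :: real
  assumes \<sigma>: "\<sigma> > 0"
begin

lemma prob_space_ndist: "prob_space (ndist \<sigma>)"
  by (rule prob_space_normal_density[OF \<sigma>])

interpretation N: prob_space "ndist \<sigma>" by (rule prob_space_ndist)
interpretation NN: pair_prob_space "ndist \<sigma>" "ndist \<sigma>" ..

lemma prob_space_cgauss: "prob_space (cgauss \<sigma>)"
  unfolding cgauss_def by (rule NN.prob_space_distr) measurable

lemma nn_integral_cgauss:
  assumes [measurable]: "f \<in> borel_measurable borel"
  shows "(\<integral>\<^sup>+z. f z \<partial>cgauss \<sigma>) = (\<integral>\<^sup>+x. \<integral>\<^sup>+y. f (Complex x y) \<partial>ndist \<sigma> \<partial>ndist \<sigma>)"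
  unfolding cgauss_def
  by (subst nn_integral_distr, measurable, subst N.nn_integral_fst[symmetric])
     (auto simp: case_prod_beta)

text \<open>A character of the plane, also after multiplication by a coordinate, is a function of Re
  z times a function of Im z; the exact Gaussian integrals below reduce to this case.\<close>

lemma integral_cgauss_mult:
  fixes g h :: "real \<Rightarrow> complex"
  assumes g: "integrable (ndist \<sigma>) g" and h: "integrable (ndist \<sigma>) h"
  shows "integrable (cgauss \<sigma>) (\<lambda>z. g (Re z) * h (Im z))"
    and "(\<integral>z. g (Re z) * h (Im z) \<partial>cgauss \<sigma>) = (\<integral>x. g x \<partial>ndist \<sigma>) * (\<integral>x. h x \<partial>ndist \<sigma>)"
proof -
  have [measurable]: "g \<in> borel_measurable borel" "h \<in> borel_measurable borel"
    using borel_measurable_integrable[OF g] borel_measurable_integrable[OF h] by auto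
  have I: "integrable (ndist \<sigma> \<Otimes>\<^sub>M ndist \<sigma>) (\<lambda>(x, y). g x * h y)"
  proof (rule NN.Fubini_integrable)
    show "integrable (ndist \<sigma>) (\<lambda>x. \<integral>y. norm (case (x, y) of (x, y) \<Rightarrow> g x * h y) \<partial>ndist \<sigma>)"
      using g h by (simp add: norm_mult)
    show "AE x in ndist \<sigma>. integrable (ndist \<sigma>) (\<lambda>y. case (x, y) of (x, y) \<Rightarrow> g x * h y)"
      using h by simp
  qed measurable
  then show "integrable (cgauss \<sigma>) (\<lambda>z. g (Re z) * h (Im z))"
    unfolding cgauss_def by (subst integrable_distr_eq) (auto simp: split_beta')
  have "(\<integral>z. g (Re z) * h (Im z) \<partial>cgauss \<sigma>) = (\<integral>p. (case p of (x, y) \<Rightarrow> g x * h y) \<partial>(ndist \<sigma> \<Otimes>\<^sub>M ndist \<sigma>))"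
    unfolding cgauss_def by (subst integral_distr) (auto simp: split_beta')
  also have "\<dots> = (\<integral>x. \<integral>y. g x * h y \<partial>ndist \<sigma> \<partial>ndist \<sigma>)"
    using NN.integral_fst'[OF I] by simp
  also have "\<dots> = (\<integral>x. g x \<partial>ndist \<sigma>) * (\<integral>x. h x \<partial>ndist \<sigma>)"
    using g h by simp
  finally show "(\<integral>z. g (Re z) * h (Im z) \<partial>cgauss \<sigma>) = (\<integral>x. g x \<partial>ndist \<sigma>) * (\<integral>x. h x \<partial>ndist \<sigma>)" .
qed

lemma integral_ndist:
  fixes f :: "real \<Rightarrow> 'b::{banach, second_countable_topology}"
  assumes "f \<in> borel_measurable borel"
  shows "(\<integral>x. f x \<partial>ndist \<sigma>) = (\<integral>x. normal_density 0 \<sigma> x *\<^sub>R f x \<partial>lborel)"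
    and "integrable (ndist \<sigma>) f \<longleftrightarrow> integrable lborel (\<lambda>x. normal_density 0 \<sigma> x *\<^sub>R f x)"
  using assms by (auto simp: integral_density integrable_density)

lemma integrable_ndist_power: "integrable (ndist \<sigma>) (\<lambda>x. x ^ k)"
  using integrable_normal_moment[OF \<sigma>, of 0 k] by (subst integral_ndist) auto

lemma integral_ndist_square: "(\<integral>x. x\<^sup>2 \<partial>ndist \<sigma>) = \<sigma>\<^sup>2"
  using integral_normal_moment_even[OF \<sigma>, of 0 1] \<sigma>
  by (subst integral_ndist) (auto simp: field_simps power2_eq_square)

lemma integrable_ndist_iexp: "integrable (ndist \<sigma>) (\<lambda>x. iexp (t * x))"
  by (rule N.integrable_const_bound[where B = 1]) auto

lemma integrable_ndist_mult_iexp: "integrable (ndist \<sigma>) (\<lambda>x. of_real x * iexp (t * x))"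
  by (rule Bochner_Integration.integrable_bound[OF integrable_ndist_power[of 1]])
     (auto simp: norm_mult)

lemma integral_ndist_iexp: "(\<integral>x. iexp (t * x) \<partial>ndist \<sigma>) = of_real (exp (- (\<sigma>\<^sup>2 * t\<^sup>2) / 2))"
proof -
  have "(\<integral>x. iexp (t * x) \<partial>ndist \<sigma>) = (\<integral>x. normal_density 0 \<sigma> x *\<^sub>R iexp (t * x) \<partial>lborel)"
    by (subst integral_ndist) auto
  also have "\<dots> = \<bar>\<sigma>\<bar> *\<^sub>R (\<integral>x. normal_density 0 \<sigma> (0 + \<sigma> * x) *\<^sub>R iexp (t * (0 + \<sigma> * x)) \<partial>lborel)"
    using \<sigma> by (intro lborel_integral_real_affine) auto
  also have "\<dots> = (\<integral>x. std_normal_density x *\<^sub>R iexp ((t * \<sigma>) * x) \<partial>lborel)"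
    using \<sigma> by (subst integral_scaleR_right[symmetric])
      (auto simp: normal_density_def real_sqrt_mult power_mult_distrib mult_ac
        intro!: Bochner_Integration.integral_cong)
  also have "\<dots> = char std_normal_distribution (t * \<sigma>)"
    unfolding char_def by (subst integral_density) auto
  also have "\<dots> = of_real (exp (- (\<sigma>\<^sup>2 * t\<^sup>2) / 2))"
    unfolding char_std_normal_distribution by (simp add: power_mult_distrib mult_ac)
  finally show ?thesis .
qed

text \<open>Gaussian integration by parts: the density n satisfies n' = -(x / \<sigma>^2) n, so the
  derivative of n(x) e^(itx) is (i t - x / \<sigma>^2) n(x) e^(itx), and it integrates to 0 over the
  line because n vanishes at both ends.\<close>

lemma integral_ndist_mult_iexp:
  "(\<integral>x. of_real x * iexp (t * x) \<partial>ndist \<sigma>) = \<i> * \<sigma>\<^sup>2 * t * of_real (exp (- (\<sigma>\<^sup>2 * t\<^sup>2) / 2))"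
proof -
  let ?n = "normal_density 0 \<sigma>"
  let ?F = "\<lambda>x. of_real (?n x) * iexp (t * x)"
  let ?f = "\<lambda>x. \<i> * t * ?F x - of_real (x / \<sigma>\<^sup>2) * ?F x"
  have i1: "integrable lborel ?F"
    using integrable_ndist_iexp[of t] by (subst (asm) integral_ndist) (auto simp: scaleR_conv_of_real)
  have i2: "integrable lborel (\<lambda>x. of_real x * ?F x)"
    using integrable_ndist_mult_iexp[of t]
    by (subst (asm) integral_ndist) (auto simp: scaleR_conv_of_real mult_ac)
  have int: "integrable lborel ?f"
    using i1 integrable_divide[OF i2, of "\<sigma>\<^sup>2"]
    by (intro Bochner_Integration.integrable_diff integrable_mult_right) auto
  have nd: "(?n has_real_derivative (- x / \<sigma>\<^sup>2 * ?n x)) (at x)" for x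
    unfolding normal_density_def[abs_def] using \<sigma>
    by (auto intro!: derivative_eq_intros simp: power2_eq_square field_simps)
  have lim: "(?n \<longlongrightarrow> 0) at_top" "(?n \<longlongrightarrow> 0) at_bot"
    unfolding normal_density_def[abs_def] using \<sigma> by real_asymp+
  have zero: "((?F \<circ> real_of_ereal) \<longlongrightarrow> 0) (at_left \<infinity>)" "((?F \<circ> real_of_ereal) \<longlongrightarrow> 0) (at_right (-\<infinity>))"
    unfolding ereal_tendsto_simps
    by (rule tendsto_norm_zero_cancel, simp add: norm_mult, rule lim)+
  have "(LBINT x=-\<infinity>..\<infinity>. ?f x) = 0 - 0"
  proof (rule interval_integral_FTC_integrable)
    fix x :: real
    show "(?F has_vector_derivative ?f x) (at x)"
    proof -
      have "((\<lambda>w. exp (\<i> * (of_real t * w))) has_field_derivative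
          \<i> * of_real t * exp (\<i> * (of_real t * of_real x))) (at (of_real x))"
        by (auto intro!: derivative_eq_intros)
      from has_vector_derivative_real_field[OF this]
      have e: "((\<lambda>x. iexp (t * x)) has_vector_derivative \<i> * t * iexp (t * x)) (at x)"
        by simp
      have n: "((\<lambda>x. complex_of_real (?n x)) has_vector_derivative of_real (- x / \<sigma>\<^sup>2 * ?n x)) (at x)"
        using nd[of x] by (intro has_vector_derivative_of_real)
          (simp only: has_real_derivative_iff_has_vector_derivative)
      show ?thesis
        using has_vector_derivative_mult[OF n e] by (simp add: algebra_simps)
    qed
    show "isCont ?f x"
      unfolding normal_density_def using \<sigma> by (intro continuous_intros) auto
  next
    show "set_integrable lborel (einterval (- \<infinity>) \<infinity>) ?f"
      using int by (simp add: set_integrable_def)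
  qed (use zero in auto)
  then have "(\<integral>x. ?f x \<partial>lborel) = 0"
    by (simp add: interval_lebesgue_integral_def set_lebesgue_integral_def)
  moreover have "(\<integral>x. ?f x \<partial>lborel) = \<i> * t * (\<integral>x. ?F x \<partial>lborel) - (\<integral>x. of_real x * ?F x \<partial>lborel) / \<sigma>\<^sup>2"
    using i1 i2 int by (subst Bochner_Integration.integral_diff) (auto simp: integrable_divide)
  ultimately have "(\<integral>x. of_real x * ?F x \<partial>lborel) = \<i> * \<sigma>\<^sup>2 * t * (\<integral>x. ?F x \<partial>lborel)"
    using \<sigma> by (simp add: field_simps)
  moreover have "(\<integral>x. ?F x \<partial>lborel) = (\<integral>x. iexp (t * x) \<partial>ndist \<sigma>)"
    by (subst integral_ndist) (auto simp: scaleR_conv_of_real)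
  moreover have "(\<integral>x. of_real x * ?F x \<partial>lborel) = (\<integral>x. of_real x * iexp (t * x) \<partial>ndist \<sigma>)"
    by (subst integral_ndist) (auto simp: scaleR_conv_of_real mult_ac)
  ultimately show ?thesis by (simp only: integral_ndist_iexp)
qed

text \<open>The real inner product of \<eta> and z; its \<open>iexp\<close> runs through the
  characters of the plane as \<eta> varies.\<close>

lemma Re_cnj_mult: "Re (cnj \<eta> * z) = Re \<eta> * Re z + Im \<eta> * Im z"
  by simp

lemma iexp_Re_cnj:
  "iexp (Re (cnj \<eta> * z)) = iexp (Re \<eta> * Re z) * iexp (Im \<eta> * Im z)"
  unfolding Re_cnj_mult by (simp add: exp_add[symmetric] algebra_simps)

lemma cgauss_iexp:
  "(\<integral>z. iexp (Re (cnj \<eta> * z)) \<partial>cgauss \<sigma>) = of_real (exp (- (\<sigma>\<^sup>2 * (norm \<eta>)\<^sup>2) / 2))"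
  unfolding iexp_Re_cnj integral_cgauss_mult(2)[OF integrable_ndist_iexp integrable_ndist_iexp]
    integral_ndist_iexp cmod_power2
  by (simp add: exp_add[symmetric] of_real_mult[symmetric] algebra_simps add_divide_distrib del: of_real_mult)

text \<open>Up to a factor this is the gradient of the characteristic function, computed coordinate
  by coordinate. At \<eta> = 0 it also yields integrability and mean 0 of a coefficient.\<close>

lemma cgauss_mult_iexp:
  shows "integrable (cgauss \<sigma>) (\<lambda>z. z * iexp (Re (cnj \<eta> * z)))"
    and "(\<integral>z. z * iexp (Re (cnj \<eta> * z)) \<partial>cgauss \<sigma>) =
      \<i> * \<sigma>\<^sup>2 * \<eta> * of_real (exp (- (\<sigma>\<^sup>2 * (norm \<eta>)\<^sup>2) / 2))"
proof -
  have eq: "z * iexp (Re (cnj \<eta> * z)) =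
      (of_real (Re z) * iexp (Re \<eta> * Re z)) * iexp (Im \<eta> * Im z) +
      \<i> * (iexp (Re \<eta> * Re z) * (of_real (Im z) * iexp (Im \<eta> * Im z)))" for z
    unfolding iexp_Re_cnj by (subst complex_eq[of z]) (simp only: algebra_simps)
  note I = integral_cgauss_mult[OF integrable_ndist_mult_iexp[of "Re \<eta>"] integrable_ndist_iexp[of "Im \<eta>"]]
    integral_cgauss_mult[OF integrable_ndist_iexp[of "Re \<eta>"] integrable_ndist_mult_iexp[of "Im \<eta>"]]
  show "integrable (cgauss \<sigma>) (\<lambda>z. z * iexp (Re (cnj \<eta> * z)))"
    unfolding eq using I(1,3) by (intro Bochner_Integration.integrable_add integrable_mult_right)
  have "(\<integral>z. z * iexp (Re (cnj \<eta> * z)) \<partial>cgauss \<sigma>) =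
     (\<i> * \<sigma>\<^sup>2 * (Re \<eta> + \<i> * Im \<eta>)) * (of_real (exp (- (\<sigma>\<^sup>2 * (Re \<eta>)\<^sup>2) / 2)) * of_real (exp (- (\<sigma>\<^sup>2 * (Im \<eta>)\<^sup>2) / 2)))"
    unfolding eq using I
    by (subst Bochner_Integration.integral_add)
       (simp_all only: integrable_mult_right integral_mult_right_zero integral_ndist_iexp
          integral_ndist_mult_iexp, simp only: algebra_simps)
  also have "\<dots> = \<i> * \<sigma>\<^sup>2 * \<eta> * of_real (exp (- (\<sigma>\<^sup>2 * (norm \<eta>)\<^sup>2) / 2))"
    unfolding cmod_power2 complex_eq[of \<eta>, symmetric] of_real_mult[symmetric] exp_add[symmetric]
    by (simp add: algebra_simps add_divide_distrib)
  finally show "(\<integral>z. z * iexp (Re (cnj \<eta> * z)) \<partial>cgauss \<sigma>) =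
      \<i> * \<sigma>\<^sup>2 * \<eta> * of_real (exp (- (\<sigma>\<^sup>2 * (norm \<eta>)\<^sup>2) / 2))" .
qed

lemma cgauss_norm_square:
  "integrable (cgauss \<sigma>) (\<lambda>z. (norm z)\<^sup>2)" "(\<integral>z. (norm z)\<^sup>2 \<partial>cgauss \<sigma>) = 2 * \<sigma>\<^sup>2"
proof -
  have 1: "integrable (ndist \<sigma>) (\<lambda>x. complex_of_real (x\<^sup>2))" "integrable (ndist \<sigma>) (\<lambda>x. 1::complex)"
    using integrable_ndist_power[of 2] by (simp_all only: complex_of_real_integrable_eq N.integrable_const)
  have eq: "complex_of_real ((norm z)\<^sup>2) = of_real ((Re z)\<^sup>2) * 1 + 1 * of_real ((Im z)\<^sup>2)" for z
    by (simp add: cmod_power2)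
  note I = integral_cgauss_mult[OF 1] integral_cgauss_mult[OF 1(2,1)]
  have sq: "(\<integral>x. complex_of_real (x\<^sup>2) \<partial>ndist \<sigma>) = of_real (\<sigma>\<^sup>2)"
    unfolding integral_complex_of_real integral_ndist_square ..
  have one: "(\<integral>x. (1::complex) \<partial>ndist \<sigma>) = 1" using N.prob_space by simp
  have *: "integrable (cgauss \<sigma>) (\<lambda>z. complex_of_real ((norm z)\<^sup>2))"
    unfolding eq by (intro Bochner_Integration.integrable_add I)
  then show "integrable (cgauss \<sigma>) (\<lambda>z. (norm z)\<^sup>2)"
    by (subst (asm) complex_of_real_integrable_eq)
  have "complex_of_real (\<integral>z. (norm z)\<^sup>2 \<partial>cgauss \<sigma>) = (\<integral>z. complex_of_real ((norm z)\<^sup>2) \<partial>cgauss \<sigma>)"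
    by (rule integral_complex_of_real[symmetric])
  also have "\<dots> = of_real (2 * \<sigma>\<^sup>2)"
    unfolding eq by (subst Bochner_Integration.integral_add[OF I(1,3)])
      (simp only: I sq one, simp)
  finally show "(\<integral>z. (norm z)\<^sup>2 \<partial>cgauss \<sigma>) = 2 * \<sigma>\<^sup>2" by (simp only: of_real_eq_iff)
qed

end

section \<open>Independent Gaussian coefficients\<close>

text \<open>The sum of n terms is normal with variance n \<sigma>^2, so its 2m-th moment is a
  constant times n^m. Markov's inequality at the level n^(m + 2) leaves n^(-2), summable for
  Borel-Cantelli, and the 2m-th root of the level is n^(1/2 + 1/m).\<close>

lemma (in prob_space) AE_normal_sum_bound:
  fixes X :: "nat \<Rightarrow> 'a \<Rightarrow> real"
  assumes indep: "indep_vars (\<lambda>_. borel) X UNIV" and \<sigma>: "\<sigma> > 0" and m: "m > 0"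
    and X: "\<And>k. distributed M lborel (X k) (normal_density 0 \<sigma>)"
  shows "AE \<omega> in M. \<exists>C. \<forall>n. \<bar>\<Sum>k<n. X k \<omega>\<bar> \<le> C * real n powr (1/2 + 1 / real m)"
proof -
  define S where "S n \<omega> = (\<Sum>k<n. X k \<omega>)" for n \<omega>
  have [measurable]: "X k \<in> borel_measurable M" for k
    using indep by (auto simp: indep_vars_def)
  have [measurable]: "S n \<in> borel_measurable M" for n unfolding S_def by measurable
  define c where "c = fact (2 * m) * \<sigma> ^ (2 * m) / (2 ^ m * fact m)"
  have c0: "c \<ge> 0" using \<sigma> by (simp add: c_def)
  have SD: "distributed M lborel (S n) (normal_density 0 (sqrt (real n) * \<sigma>))" if "n > 0" for n
  proof -
    have "distributed M lborel (\<lambda>\<omega>. \<Sum>k<n. X k \<omega>) (normal_density (\<Sum>k<n. 0) (sqrt (\<Sum>k<n. \<sigma>\<^sup>2)))"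
      using that \<sigma> X indep_vars_subset[OF indep] by (intro sum_indep_normal) auto
    then show ?thesis using \<sigma> by (simp add: S_def[abs_def] real_sqrt_mult)
  qed
  have mom: "integrable M (\<lambda>\<omega>. S n \<omega> ^ (2 * m))" "expectation (\<lambda>\<omega>. S n \<omega> ^ (2 * m)) = c * real n ^ m"
    if n: "n > 0" for n
  proof -
    have s: "sqrt (real n) * \<sigma> > 0" using n \<sigma> by simp
    show "integrable M (\<lambda>\<omega>. S n \<omega> ^ (2 * m))"
      using distributed_integrable[OF SD[OF n], of "\<lambda>x. x ^ (2 * m)"]
        integrable_normal_moment[OF s, of 0 "2 * m"] by simp
    have "expectation (\<lambda>\<omega>. S n \<omega> ^ (2 * m)) =
        (\<integral>x. normal_density 0 (sqrt (real n) * \<sigma>) x * x ^ (2 * m) \<partial>lborel)"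
      by (rule distributed_integral[OF SD[OF n], symmetric]) auto
    also have "\<dots> = fact (2 * m) / ((2 / (sqrt (real n) * \<sigma>)\<^sup>2) ^ m * fact m)"
      using integral_normal_moment_even[OF s, of 0 m] by simp
    also have "\<dots> = c * real n ^ m"
      using n \<sigma> by (simp add: c_def power_mult_distrib power_divide power_mult[symmetric] field_simps)
    finally show "expectation (\<lambda>\<omega>. S n \<omega> ^ (2 * m)) = c * real n ^ m" .
  qed
  define A where "A n = {\<omega> \<in> space M. S n \<omega> ^ (2 * m) \<ge> real n ^ (m + 2)}" for n
  have [measurable]: "A n \<in> sets M" for n unfolding A_def by measurable
  have "summable (\<lambda>n. measure M (A n))"
  proof (rule summable_comparison_test'[where N = 1])
    show "summable (\<lambda>n. c * real n powr (-2))"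
      by (intro summable_mult) (simp add: summable_real_powr_iff)
    fix n :: nat assume n: "n \<ge> 1"
    have "measure M (A n) \<le> (\<integral>\<omega>. S n \<omega> ^ (2 * m) \<partial>M) / real n ^ (m + 2)"
      unfolding A_def using n mom[of n] by (intro integral_Markov_inequality_measure[where A = "{}"]) auto
    also have "\<dots> = c * real n powr (-2)"
      using n mom[of n] by (simp add: power_add powr_minus powr_realpow field_simps powr_numeral power2_eq_square)
    finally show "norm (measure M (A n)) \<le> c * real n powr (-2)" by simp
  qed
  then have "AE \<omega> in M. eventually (\<lambda>n. \<omega> \<in> space M - A n) sequentially"
    by (intro borel_cantelli_AE1) (auto simp: less_top[symmetric])
  then show ?thesis
  proof eventually_elim
    case (elim \<omega>)
    then obtain N where N: "\<And>n. n \<ge> N \<Longrightarrow> \<omega> \<in> space M - A n"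
      by (auto simp: eventually_sequentially)
    \<comment> \<open>The 1 serves all n \<ge> N, the sum serves the finitely many earlier
      n.\<close>
    define C where "C = 1 + (\<Sum>j<N. \<bar>S j \<omega>\<bar>)"
    have C1: "C \<ge> 1" by (simp add: C_def sum_nonneg)
    have "\<bar>S n \<omega>\<bar> \<le> C * real n powr (1/2 + 1 / real m)" for n
    proof (cases "n = 0")
      case True
      then show ?thesis by (simp add: S_def)
    next
      case False
      then have p1: "real n powr (1/2 + 1 / real m) \<ge> 1" by (intro ge_one_powr_ge_zero) auto
      show ?thesis
      proof (cases "n < N")
        case True
        then have "\<bar>S n \<omega>\<bar> \<le> (\<Sum>j<N. \<bar>S j \<omega>\<bar>)" by (intro member_le_sum) auto
        also have "\<dots> \<le> C * 1" by (simp add: C_def)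
        also have "\<dots> \<le> C * real n powr (1/2 + 1 / real m)"
          using p1 C1 by (intro mult_left_mono) auto
        finally show ?thesis .
      next
        case False
        then have "\<not> S n \<omega> ^ (2 * m) \<ge> real n ^ (m + 2)" using N[of n] by (auto simp: A_def)
        then have lt: "\<bar>S n \<omega>\<bar> ^ (2 * m) < real n ^ (m + 2)" by (simp add: power_even_abs)
        have "(real n powr (1/2 + 1 / real m)) ^ (2 * m) = real n powr ((1/2 + 1 / real m) * real (2 * m))"
          using \<open>n \<noteq> 0\<close> by (subst powr_powr[symmetric], subst powr_realpow) auto
        also have "(1/2 + 1 / real m) * real (2 * m) = real (m + 2)"
          using m by (simp add: field_simps)
        also have "real n powr real (m + 2) = real n ^ (m + 2)"
          using \<open>n \<noteq> 0\<close> by (subst powr_realpow) auto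
        finally have "\<bar>S n \<omega>\<bar> ^ (2 * m) < (real n powr (1/2 + 1 / real m)) ^ (2 * m)" using lt by simp
        then have "\<bar>S n \<omega>\<bar> < real n powr (1/2 + 1 / real m)"
          by (rule power_less_imp_less_base) simp
        also have "\<dots> \<le> C * real n powr (1/2 + 1 / real m)"
          using mult_right_mono[OF C1, of "real n powr (1/2 + 1 / real m)"] by simp
        finally show ?thesis by simp
      qed
    qed
    then show ?case by (auto simp: S_def)
  qed
qed

locale iid_gauss = prob_space M for M :: "'a measure" +
  fixes a :: "nat \<Rightarrow> 'a \<Rightarrow> complex" and \<sigma> :: real
  assumes \<sigma>: "\<sigma> > 0"
    and indep: "indep_vars (\<lambda>_. borel) a UNIV"
    and normal: "\<And>k. complex_normal M \<sigma> (a k)"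
begin

sublocale N: prob_space "ndist \<sigma>" by (rule prob_space_ndist[OF \<sigma>])
sublocale NN: pair_prob_space "ndist \<sigma>" "ndist \<sigma>" ..
sublocale G: prob_space "cgauss \<sigma>" by (rule prob_space_cgauss[OF \<sigma>])

lemma a_measurable [measurable]: "a k \<in> borel_measurable M"
  using indep by (auto simp: indep_vars_def)

lemma distr_a: "distr M borel (a k) = cgauss \<sigma>"
proof -
  have 1: "distr M (lborel \<Otimes>\<^sub>M lborel) (\<lambda>\<omega>. (Re (a k \<omega>), Im (a k \<omega>))) =
      density (lborel \<Otimes>\<^sub>M lborel) (\<lambda>(x, y). ennreal (normal_density 0 \<sigma> x * normal_density 0 \<sigma> y))"
    using normal[of k] unfolding complex_normal_def by (rule distributed_distr_eq_density)
  also have "\<dots> = ndist \<sigma> \<Otimes>\<^sub>M ndist \<sigma>"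
    by (subst pair_measure_density)
       (auto simp: ennreal_mult' lborel.sigma_finite_measure_axioms N.sigma_finite_measure_axioms)
  finally have eq: "distr M (lborel \<Otimes>\<^sub>M lborel) (\<lambda>\<omega>. (Re (a k \<omega>), Im (a k \<omega>))) = ndist \<sigma> \<Otimes>\<^sub>M ndist \<sigma>" .
  show ?thesis
    unfolding cgauss_def eq[symmetric] by (subst distr_distr) (auto simp: comp_def)
qed

lemma indep_Re: "indep_vars (\<lambda>_. borel) (\<lambda>k \<omega>. Re (a k \<omega>)) UNIV"
  and indep_Im: "indep_vars (\<lambda>_. borel) (\<lambda>k \<omega>. Im (a k \<omega>)) UNIV"
  by (rule indep_vars_compose2[OF indep], simp)+

lemma distributed_Re_Im:
  "distributed M lborel (\<lambda>\<omega>. Re (a k \<omega>)) (normal_density 0 \<sigma>)"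
  "distributed M lborel (\<lambda>\<omega>. Im (a k \<omega>)) (normal_density 0 \<sigma>)"
proof -
  have "distr M lborel (\<lambda>\<omega>. Re (a k \<omega>)) = distr (distr M borel (a k)) lborel Re"
    by (subst distr_distr) (auto simp: comp_def)
  also have "\<dots> = distr (ndist \<sigma> \<Otimes>\<^sub>M ndist \<sigma>) lborel fst"
    unfolding distr_a cgauss_def by (subst distr_distr) (auto simp: comp_def split_beta')
  also have "\<dots> = distr (ndist \<sigma> \<Otimes>\<^sub>M ndist \<sigma>) (ndist \<sigma>) fst"
    by (rule distr_cong) auto
  also have "\<dots> = ndist \<sigma>" by (rule N.distr_pair_fst)
  finally show "distributed M lborel (\<lambda>\<omega>. Re (a k \<omega>)) (normal_density 0 \<sigma>)"
    by (simp add: distributed_def)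
  have "distr M lborel (\<lambda>\<omega>. Im (a k \<omega>)) = distr (distr M borel (a k)) lborel Im"
    by (subst distr_distr) (auto simp: comp_def)
  also have "\<dots> = distr (ndist \<sigma> \<Otimes>\<^sub>M ndist \<sigma>) lborel snd"
    unfolding distr_a cgauss_def by (subst distr_distr) (auto simp: comp_def split_beta')
  also have "\<dots> = distr (distr (ndist \<sigma> \<Otimes>\<^sub>M ndist \<sigma>) (ndist \<sigma> \<Otimes>\<^sub>M ndist \<sigma>) (\<lambda>(x, y). (y, x))) lborel snd"
    using NN.distr_pair_swap by simp
  also have "\<dots> = distr (ndist \<sigma> \<Otimes>\<^sub>M ndist \<sigma>) (ndist \<sigma>) fst"
    by (subst distr_distr) (auto simp: comp_def split_beta' intro!: distr_cong)
  also have "\<dots> = ndist \<sigma>" by (rule N.distr_pair_fst)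
  finally show "distributed M lborel (\<lambda>\<omega>. Im (a k \<omega>)) (normal_density 0 \<sigma>)"
    by (simp add: distributed_def)
qed

text \<open>Real and imaginary parts are bounded separately, and the exceptional sets for all m form
  a countable union. No z occurs, so one null set serves the whole half-plane.\<close>

lemma AE_sqrt_cancel: "AE \<omega> in M. sqrt_cancel (\<lambda>k. a k \<omega>)"
proof -
  have "AE \<omega> in M. \<exists>C. \<forall>n. norm (\<Sum>k<n. a k \<omega>) \<le> C * real n powr (1/2 + 1 / real m)"
    if m: "m > 0" for m
    using AE_normal_sum_bound[OF indep_Re \<sigma> m distributed_Re_Im(1)]
      AE_normal_sum_bound[OF indep_Im \<sigma> m distributed_Re_Im(2)]
  proof eventually_elim
    case (elim \<omega>)
    then obtain C D where
      "\<And>n. \<bar>\<Sum>k<n. Re (a k \<omega>)\<bar> \<le> C * real n powr (1/2 + 1 / real m)"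
      "\<And>n. \<bar>\<Sum>k<n. Im (a k \<omega>)\<bar> \<le> D * real n powr (1/2 + 1 / real m)" by blast
    then have "norm (\<Sum>k<n. a k \<omega>) \<le> (C + D) * real n powr (1/2 + 1 / real m)" for n
      using cmod_le[of "\<Sum>k<n. a k \<omega>"] add_mono order_trans
      unfolding Re_sum Im_sum distrib_right by blast
    then show ?case by blast
  qed
  then have "AE \<omega> in M. \<forall>m. m > 0 \<longrightarrow> (\<exists>C. \<forall>n. norm (\<Sum>k<n. a k \<omega>) \<le> C * real n powr (1/2 + 1 / real m))"
    by (subst AE_all_countable) (auto simp: AE_impI)
  then show ?thesis unfolding sqrt_cancel_def by simp
qed

text \<open>Conditioning on all coefficients except \<open>a 0\<close>, in the form of Fubini: the
  rest of the sequence is frozen while its first entry is integrated out. Both the null set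
  arguments and the bound on 1/|f| start from here.\<close>

lemma nn_integral_resample:
  assumes F [measurable]: "F \<in> borel_measurable (PiM UNIV (\<lambda>_. borel))"
  shows "(\<integral>\<^sup>+\<omega>. F (\<lambda>k. a k \<omega>) \<partial>M) = (\<integral>\<^sup>+\<omega>. (\<integral>\<^sup>+c. F ((\<lambda>k. a k \<omega>)(0 := c)) \<partial>cgauss \<sigma>) \<partial>M)"
proof -
  let ?P = "PiM (-{0}) (\<lambda>_::nat. borel :: complex measure)"
  define tail where "tail \<omega> = restrict (\<lambda>k. a k \<omega>) (-{0})" for \<omega>
  define glue :: "complex \<times> (nat \<Rightarrow> complex) \<Rightarrow> nat \<Rightarrow> complex"
    where "glue p k = (if k = 0 then fst p else snd p k)" for p k
  have [measurable]: "tail \<in> measurable M ?P"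
    unfolding tail_def by measurable
  have [measurable]: "glue \<in> measurable (borel \<Otimes>\<^sub>M ?P) (PiM UNIV (\<lambda>_. borel))"
  proof (rule measurable_PiM_single')
    show "(\<lambda>p. glue p k) \<in> borel_measurable (borel \<Otimes>\<^sub>M ?P)" for k
      unfolding glue_def by (cases "k = 0") auto
  qed auto
  have glue: "glue (c, tail \<omega>) = (\<lambda>k. a k \<omega>)(0 := c)" for c \<omega>
    by (auto simp: glue_def tail_def)
  let ?Q = "PiM {0} (\<lambda>_::nat. borel :: complex measure)"
  define head where "head \<omega> = restrict (\<lambda>k. a k \<omega>) {0}" for \<omega>
  have [measurable]: "head \<in> measurable M ?Q"
    unfolding head_def by measurable
  have [measurable]: "(\<lambda>u. u 0) \<in> borel_measurable ?Q" by simp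
  have "indep_var ?P tail ?Q head"
    unfolding tail_def head_def by (rule indep_var_restrict[OF indep]) auto
  then have eq: "distr M ?P tail \<Otimes>\<^sub>M distr M ?Q head = distr M (?P \<Otimes>\<^sub>M ?Q) (\<lambda>\<omega>. (tail \<omega>, head \<omega>))"
    unfolding indep_var_distribution_eq by simp
  interpret Q: prob_space "distr M ?Q head" by (rule prob_space_distr) simp
  have "(\<integral>\<^sup>+\<omega>. F (\<lambda>k. a k \<omega>) \<partial>M) = (\<integral>\<^sup>+\<omega>. F (glue (head \<omega> 0, tail \<omega>)) \<partial>M)"
    unfolding glue by (simp add: fun_upd_idem head_def)
  also have "\<dots> = (\<integral>\<^sup>+p. F (glue (snd p 0, fst p)) \<partial>(distr M ?P tail \<Otimes>\<^sub>M distr M ?Q head))"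
    unfolding eq by (subst nn_integral_distr) auto
  also have "\<dots> = (\<integral>\<^sup>+t. \<integral>\<^sup>+u. F (glue (u 0, t)) \<partial>distr M ?Q head \<partial>distr M ?P tail)"
    by (subst Q.nn_integral_fst[symmetric]) auto
  also have "\<dots> = (\<integral>\<^sup>+\<omega>. (\<integral>\<^sup>+u. F (glue (u 0, tail \<omega>)) \<partial>distr M ?Q head) \<partial>M)"
    by (subst nn_integral_distr) auto
  also have "\<dots> = (\<integral>\<^sup>+\<omega>. (\<integral>\<^sup>+c. F (glue (c, tail \<omega>)) \<partial>cgauss \<sigma>) \<partial>M)"
  proof (rule nn_integral_cong)
    fix \<omega> assume [measurable]: "\<omega> \<in> space M"
    have "(\<integral>\<^sup>+u. F (glue (u 0, tail \<omega>)) \<partial>distr M ?Q head) = (\<integral>\<^sup>+\<omega>'. F (glue (a 0 \<omega>', tail \<omega>)) \<partial>M)"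
      by (subst nn_integral_distr) (auto simp: head_def)
    also have "\<dots> = (\<integral>\<^sup>+c. F (glue (c, tail \<omega>)) \<partial>distr M borel (a 0))"
      by (subst nn_integral_distr) auto
    finally show "(\<integral>\<^sup>+u. F (glue (u 0, tail \<omega>)) \<partial>distr M ?Q head) = (\<integral>\<^sup>+c. F (glue (c, tail \<omega>)) \<partial>cgauss \<sigma>)"
      unfolding distr_a .
  qed
  finally show ?thesis unfolding glue .
qed

end

section \<open>Simplicity of zeros and the reciprocal moment\<close>

text \<open>The point may vary along with the coefficients: this joint version is what Fubini on a
  side of the rectangle requires, while the conditioning on sequence space uses a fixed point and
  free coefficients.\<close>

lemma dirichlet_measurable [measurable (raw)]:
  assumes [measurable]: "\<And>k. (\<lambda>x. s x k) \<in> borel_measurable M" "g \<in> borel_measurable M"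
  shows "(\<lambda>x. dirichlet (s x) (g x)) \<in> borel_measurable M"
proof -
  have [measurable]: "(exp :: complex \<Rightarrow> complex) \<in> borel_measurable borel"
    by (intro borel_measurable_continuous_onI continuous_intros)
  have "of_nat (Suc k) powr z = exp (z * ln (of_nat (Suc k)))" for k and z :: complex
    using of_nat_neq_0[of k, where 'a = complex] by (simp add: powr_def del: of_nat_Suc)
  then show ?thesis unfolding dirichlet_def by simp
qed

lemma dlog_measurable [measurable (raw)]:
  assumes [measurable]: "(\<lambda>x. s x k) \<in> borel_measurable M"
  shows "(\<lambda>x. dlog (s x) k) \<in> borel_measurable M"
  unfolding dlog_def by measurable

lemma dlog_upd0 [simp]: "dlog (s(0 := c)) = dlog s"
  by (auto simp: dlog_def fun_eq_iff)

text \<open>As 1 to the power z is 1, the first coefficient is an additive constant of f; this is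
  the form f = c + g on which the conditioning rests.\<close>

lemma dirichlet_upd0:
  assumes s: "sqrt_cancel s" and z: "Re z > 1/2"
  shows "dirichlet (s(0 := c)) z = dirichlet s z - s 0 + c"
proof -
  have "(\<lambda>k. if k = 0 then c - s 0 else 0) sums (c - s 0)"
    using sums_single[of 0 "\<lambda>_. c - s 0"] by simp
  from sums_add[OF dirichlet_sums[OF s z] this]
  have "(\<lambda>k. s k / of_nat (Suc k) powr z + (if k = 0 then c - s 0 else 0)) sums (dirichlet s z + (c - s 0))" .
  also have "(\<lambda>k. s k / of_nat (Suc k) powr z + (if k = 0 then c - s 0 else 0)) =
      (\<lambda>k. (s(0 := c)) k / of_nat (Suc k) powr z)"
    by (auto simp: fun_eq_iff)
  finally show ?thesis
    using sums_unique2 dirichlet_sums[OF sqrt_cancel_upd0[OF s] z] by fastforce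
qed

text \<open>From |x| |y| \<le> x^2 + y^2. The planar singularity splits into two integrable
  one-dimensional ones, which replaces polar coordinates.\<close>

lemma inverse_norm_Complex_le:
  assumes "x \<noteq> 0" "y \<noteq> 0"
  shows "inverse (norm (Complex x y)) \<le> \<bar>x\<bar> powr - (1/2) * \<bar>y\<bar> powr - (1/2)"
proof -
  have "2 * (\<bar>x\<bar> * \<bar>y\<bar>) \<le> x\<^sup>2 + y\<^sup>2"
    using sum_squares_bound[of "\<bar>x\<bar>" "\<bar>y\<bar>"] by (simp add: mult.assoc)
  moreover have "0 \<le> \<bar>x\<bar> * \<bar>y\<bar>" by simp
  ultimately have "\<bar>x\<bar> * \<bar>y\<bar> \<le> x\<^sup>2 + y\<^sup>2" by linarith
  then have "sqrt (\<bar>x\<bar> * \<bar>y\<bar>) \<le> norm (Complex x y)"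
    by (simp add: complex_norm)
  then have "inverse (norm (Complex x y)) \<le> inverse (sqrt (\<bar>x\<bar> * \<bar>y\<bar>))"
    using assms by (intro le_imp_inverse_le) auto
  also have "\<dots> = \<bar>x\<bar> powr - (1/2) * \<bar>y\<bar> powr - (1/2)"
    using assms by (simp add: powr_half_sqrt[symmetric] powr_minus powr_mult)
  finally show ?thesis .
qed

text \<open>The value is 2 + 2: the integral of x^(-1/2) over [0, 1] is 2, and the negative half is
  its mirror image.\<close>

lemma nn_integral_inv_sqrt:
  "(\<integral>\<^sup>+x. ennreal (\<bar>x\<bar> powr - (1/2)) * indicator {-1..1::real} x \<partial>lborel) \<le> ennreal 4"
proof -
  let ?h = "\<lambda>x::real. ennreal (\<bar>x\<bar> powr - (1/2)) * indicator {0..1} x"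
  have 1: "(\<integral>\<^sup>+x. ?h x \<partial>lborel) = ennreal 2"
  proof -
    have "((\<lambda>x::real. x powr - (1/2)) has_integral (1 powr (- (1/2) + 1) / (- (1/2) + 1))) {0..1}"
      by (rule has_integral_powr_from_0) auto
    from nn_integral_has_integral_lebesgue'[OF _ this]
    have "(\<integral>\<^sup>+x. ennreal (x powr - (1/2)) * indicator {0..1} x \<partial>lborel) = ennreal 2" by simp
    also have "(\<integral>\<^sup>+x. ennreal (x powr - (1/2)) * indicator {0..1} x \<partial>lborel) = (\<integral>\<^sup>+x. ?h x \<partial>lborel)"
      by (intro nn_integral_cong) (auto split: split_indicator)
    finally show ?thesis .
  qed
  have 2: "(\<integral>\<^sup>+x. ?h (- x) \<partial>lborel) = ennreal 2"
    using nn_integral_real_affine[of ?h "-1" 0] 1 by simp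
  have "(\<integral>\<^sup>+x. ennreal (\<bar>x\<bar> powr - (1/2)) * indicator {-1..1::real} x \<partial>lborel)
      \<le> (\<integral>\<^sup>+x. ?h x + ?h (- x) \<partial>lborel)"
    by (intro nn_integral_mono) (auto split: split_indicator)
  also have "\<dots> = ennreal 2 + ennreal 2"
    using 1 2 by (subst nn_integral_add) auto
  finally show ?thesis by (simp add: ennreal_plus[symmetric] del: ennreal_plus)
qed

text \<open>Where |x + b| > 1 the integrand is at most 1, which contributes at most 1. Near the
  singularity the density is at most its value at 0, and the remaining integral is at most 4 by
  translation invariance, whatever b is.\<close>

lemma nn_integral_ndist_inv_sqrt:
  assumes \<sigma>: "\<sigma> > 0"
  shows "(\<integral>\<^sup>+x. ennreal (\<bar>x + b\<bar> powr - (1/2)) \<partial>ndist \<sigma>) \<le> ennreal (1 + normal_density 0 \<sigma> 0 * 4)"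
proof -
  interpret N: prob_space "ndist \<sigma>" by (rule prob_space_ndist[OF \<sigma>])
  let ?B = "normal_density 0 \<sigma> 0"
  let ?h = "\<lambda>x::real. ennreal (\<bar>x\<bar> powr - (1/2)) * indicator {-1..1} x"
  have B: "normal_density 0 \<sigma> x \<le> ?B" for x
    by (simp add: normal_density_def divide_right_mono)
  have "(\<integral>\<^sup>+x. ennreal (\<bar>x + b\<bar> powr - (1/2)) \<partial>ndist \<sigma>) \<le> (\<integral>\<^sup>+x. 1 + ?h (x + b) \<partial>ndist \<sigma>)"
  proof (rule nn_integral_mono)
    fix x
    show "ennreal (\<bar>x + b\<bar> powr - (1/2)) \<le> 1 + ?h (x + b)"
    proof (cases "x + b \<in> {-1..1}")
      case False
      then have "\<bar>x + b\<bar> powr - (1/2) \<le> 1 powr - (1/2)" by (intro powr_mono2') auto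
      then show ?thesis using False by (simp add: ennreal_le_1)
    qed auto
  qed
  also have "\<dots> = 1 + (\<integral>\<^sup>+x. ?h (x + b) \<partial>ndist \<sigma>)"
    using N.emeasure_space_1 by (subst nn_integral_add) auto
  also have "(\<integral>\<^sup>+x. ?h (x + b) \<partial>ndist \<sigma>) \<le> (\<integral>\<^sup>+x. ennreal ?B * ?h (b + 1 * x) \<partial>lborel)"
    by (subst nn_integral_density) (auto intro!: nn_integral_mono mult_right_mono ennreal_leI B simp: add.commute)
  also have "\<dots> = ennreal ?B * (\<integral>\<^sup>+x. ?h x \<partial>lborel)"
    using nn_integral_real_affine[of ?h 1 b] by (subst nn_integral_cmult) auto
  also have "\<dots> \<le> ennreal ?B * ennreal 4"
    by (intro mult_left_mono nn_integral_inv_sqrt) auto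
  also have "1 + ennreal ?B * ennreal 4 = ennreal (1 + ?B * 4)"
    by (simp add: ennreal_plus ennreal_mult)
  finally show ?thesis by (simp add: add_left_mono)
qed

text \<open>Uniformity in w is the point: w will be the random remainder of the series. The square
  comes from one factor per coordinate.\<close>

lemma cgauss_inverse_norm_bound:
  assumes \<sigma>: "\<sigma> > 0"
  shows "(\<integral>\<^sup>+c. ennreal (inverse (norm (c + w))) \<partial>cgauss \<sigma>) \<le> ennreal ((1 + normal_density 0 \<sigma> 0 * 4)\<^sup>2)"
proof -
  let ?B = "1 + normal_density 0 \<sigma> 0 * 4"
  let ?h = "\<lambda>b x. ennreal (\<bar>x + b\<bar> powr - (1/2))"
  \<comment> \<open>As \<open>0 powr - (1/2)\<close> is 0, the product bound fails where exactly one
    coordinate vanishes; such points form a null set.\<close>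
  have ae: "AE x in ndist \<sigma>. x + b \<noteq> 0" for b
  proof -
    have "AE x in lborel. x \<noteq> - b" by (rule AE_lborel_singleton)
    then show ?thesis by (subst AE_density) (auto elim!: eventually_mono)
  qed
  have "(\<integral>\<^sup>+c. ennreal (inverse (norm (c + w))) \<partial>cgauss \<sigma>) =
      (\<integral>\<^sup>+x. \<integral>\<^sup>+y. ennreal (inverse (norm (Complex (x + Re w) (y + Im w)))) \<partial>ndist \<sigma> \<partial>ndist \<sigma>)"
  proof -
    have "Complex x y + w = Complex (x + Re w) (y + Im w)" for x y by (simp add: complex_eq_iff)
    then show ?thesis by (subst nn_integral_cgauss[OF \<sigma>]) auto
  qed
  also have "\<dots> \<le> (\<integral>\<^sup>+x. \<integral>\<^sup>+y. ?h (Re w) x * ?h (Im w) y \<partial>ndist \<sigma> \<partial>ndist \<sigma>)"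
  proof (rule nn_integral_mono_AE)
    show "AE x in ndist \<sigma>. (\<integral>\<^sup>+y. ennreal (inverse (norm (Complex (x + Re w) (y + Im w)))) \<partial>ndist \<sigma>)
        \<le> (\<integral>\<^sup>+y. ?h (Re w) x * ?h (Im w) y \<partial>ndist \<sigma>)"
      using ae[of "Re w"]
    proof eventually_elim
      case (elim x)
      show ?case
      proof (rule nn_integral_mono_AE)
        show "AE y in ndist \<sigma>. ennreal (inverse (norm (Complex (x + Re w) (y + Im w)))) \<le> ?h (Re w) x * ?h (Im w) y"
          using ae[of "Im w"]
          by eventually_elim
            (use elim in \<open>auto simp: ennreal_mult'[symmetric] intro!: ennreal_leI inverse_norm_Complex_le\<close>)
      qed
    qed
  qed
  also have "\<dots> = (\<integral>\<^sup>+x. ?h (Re w) x \<partial>ndist \<sigma>) * (\<integral>\<^sup>+y. ?h (Im w) y \<partial>ndist \<sigma>)"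
    by (simp add: nn_integral_cmult nn_integral_multc)
  also have "\<dots> \<le> ennreal ?B * ennreal ?B"
    by (intro mult_mono nn_integral_ndist_inv_sqrt \<sigma>) auto
  also have "\<dots> = ennreal (?B\<^sup>2)"
    unfolding power2_eq_square by (rule ennreal_mult[symmetric]) auto
  finally show ?thesis .
qed

text \<open>The law has a density on the plane; the linear map z to (Re z, Im z) carries negligible
  sets of complex numbers to null sets of the product measure.\<close>

lemma cgauss_negligible:
  assumes \<sigma>: "\<sigma> > 0" and S [measurable]: "S \<in> sets borel" and neg: "negligible S"
  shows "emeasure (cgauss \<sigma>) S = 0"
proof -
  interpret N: prob_space "ndist \<sigma>" by (rule prob_space_ndist[OF \<sigma>])
  let ?T = "{p. Complex (fst p) (snd p) \<in> S}"
  have Tm: "(\<lambda>p. Complex (fst p) (snd p)) \<in> borel_measurable borel"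
    by (intro borel_measurable_Complex borel_measurable_continuous_onI continuous_intros)
  have T [measurable]: "?T \<in> sets borel"
    using measurable_sets[OF Tm S] by (simp add: vimage_def)
  have "?T = (\<lambda>z. (Re z, Im z)) ` S"
    by (force simp: image_iff)
  moreover have "negligible ((\<lambda>z. (Re z, Im z)) ` S)"
  proof (rule negligible_differentiable_image_negligible[OF _ neg])
    have "linear (\<lambda>z. (Re z, Im z))" by (auto intro!: linearI)
    then show "(\<lambda>z. (Re z, Im z)) differentiable_on S" by (rule linear_imp_differentiable_on)
  qed simp
  ultimately have "?T \<in> null_sets lebesgue" by (simp add: negligible_iff_null_sets)
  then have T0: "?T \<in> null_sets (lborel \<Otimes>\<^sub>M lborel)"
    unfolding lborel_prod using T by (auto simp: null_sets_def)
  have "ndist \<sigma> \<Otimes>\<^sub>M ndist \<sigma> = density (lborel \<Otimes>\<^sub>M lborel) (\<lambda>(x, y). ennreal (normal_density 0 \<sigma> x) * ennreal (normal_density 0 \<sigma> y))"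
    by (rule pair_measure_density)
      (auto simp: lborel.sigma_finite_measure_axioms N.sigma_finite_measure_axioms)
  moreover have "AE p in lborel \<Otimes>\<^sub>M lborel. p \<notin> ?T" using T0 by (rule AE_not_in)
  ultimately have "AE p in ndist \<sigma> \<Otimes>\<^sub>M ndist \<sigma>. p \<notin> ?T"
    by (simp only:, subst AE_density) (auto simp: split_beta' elim!: eventually_mono)
  moreover have "?T \<in> sets (ndist \<sigma> \<Otimes>\<^sub>M ndist \<sigma>)"
    using T by (simp add: borel_prod[symmetric] cong: sets_pair_measure_cong)
  ultimately have "emeasure (ndist \<sigma> \<Otimes>\<^sub>M ndist \<sigma>) ?T = 0"
    by (subst (asm) AE_iff_measurable[where N = ?T]) (auto simp: space_pair_measure)
  then show ?thesis
    unfolding cgauss_def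
    by (subst emeasure_distr) (auto simp: vimage_def split_beta' space_pair_measure)
qed

context iid_gauss
begin

text \<open>Treats zeros on a thin set (\<theta> = 0) and multiple zeros (\<theta> = 1) at once.
  With the other coefficients frozen, f = c + g and f' = g', so a bad value c lies in minus the
  g-image of the points of K where \<theta> g' = 0; that image is negligible by
  \<open>neg\<close>.\<close>

lemma AE_no_common_zero:
  assumes K: "compact K" "K \<subseteq> {z. Re z > 1/2}"
    and neg: "\<And>s. sqrt_cancel s \<Longrightarrow>
      negligible (dirichlet s ` {z \<in> K. \<theta> * dirichlet (dlog s) z = 0})"
    and cont: "\<And>s. sqrt_cancel s \<Longrightarrow> continuous_on K (dirichlet (dlog s))"
  shows "AE \<omega> in M. \<forall>z\<in>K. \<not> (dirichlet (\<lambda>k. a k \<omega>) z = 0 \<and> \<theta> * dirichlet (dlog (\<lambda>k. a k \<omega>)) z = 0)"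
proof -
  obtain D where D: "countable D" "D \<subseteq> K" "K \<subseteq> closure D" using separable by blast
  define \<phi> where "\<phi> s z = norm (dirichlet s z) + norm (\<theta> * dirichlet (dlog s) z)" for s z
  \<comment> \<open>The event itself quantifies over uncountably many points. This version over a
    countable dense subset is measurable, and for sequences with \<open>sqrt_cancel\<close> it is
    equivalent to a zero of \<phi> on K, by compactness of K and continuity of \<phi>.\<close>
  define E where "E s \<longleftrightarrow> (\<forall>n. \<exists>z\<in>D. \<phi> s z < 1 / real (Suc n))" for s
  have cont\<phi>: "continuous_on K (\<phi> s)" if "sqrt_cancel s" for s
    unfolding \<phi>_def using cont[OF that] holomorphic_on_imp_continuous_on
      [OF holomorphic_on_subset[OF holomorphic_dirichlet[OF that] K(2)]]
    by (intro continuous_intros)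
  have E_imp: "\<exists>z\<in>K. \<phi> s z = 0" if ES: "E s" and cs: "sqrt_cancel s" for s
  proof -
    have "K \<noteq> {}" using \<open>E s\<close> D by (auto simp: E_def)
    then obtain z where z: "z \<in> K" "\<And>w. w \<in> K \<Longrightarrow> \<phi> s z \<le> \<phi> s w"
      using continuous_attains_inf[OF K(1) _ cont\<phi>[OF cs]] by blast
    have "\<phi> s z \<le> 1 / real (Suc n)" for n
      using \<open>E s\<close> z D by (force simp: E_def dest: spec[of _ n])
    then have "\<phi> s z \<le> 0"
      by (intro LIMSEQ_le_const[OF LIMSEQ_Suc[OF lim_1_over_n]]) auto
    then show ?thesis using z by (intro bexI[of _ z]) (auto simp: \<phi>_def intro: antisym)
  qed
  have imp_E: "E s" if z: "z \<in> K" "\<phi> s z = 0" and s: "sqrt_cancel s" for s z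
    unfolding E_def
  proof
    fix n
    obtain d where d: "d > 0" "\<And>w. w \<in> K \<Longrightarrow> dist w z < d \<Longrightarrow> dist (\<phi> s w) (\<phi> s z) < 1 / real (Suc n)"
      using cont\<phi>[OF s] z unfolding continuous_on_iff
      by (metis of_nat_0_less_iff zero_less_Suc zero_less_divide_1_iff)
    obtain w where "w \<in> D" "dist w z < d"
      using D z d closure_approachable by blast
    then have "\<phi> s w < 1 / real (Suc n)"
      using d(2)[of w] D z by (auto simp: dist_real_def)
    then show "\<exists>z\<in>D. \<phi> s z < 1 / real (Suc n)" using \<open>w \<in> D\<close> by blast
  qed
  have [measurable]: "Measurable.pred (PiM UNIV (\<lambda>_. borel)) E"
    unfolding E_def \<phi>_def using D(1) by measurable
  have [measurable]: "(\<lambda>\<omega> k. a k \<omega>) \<in> measurable M (PiM UNIV (\<lambda>_. borel))"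
    by (rule measurable_PiM_single') auto
  have "(\<integral>\<^sup>+\<omega>. indicator {s. E s} (\<lambda>k. a k \<omega>) \<partial>M) =
     (\<integral>\<^sup>+\<omega>. \<integral>\<^sup>+c. indicator {s. E s} ((\<lambda>k. a k \<omega>)(0 := c)) \<partial>cgauss \<sigma> \<partial>M)"
    by (rule nn_integral_resample) (auto simp: pred_def space_PiM)
  also have "\<dots> = (\<integral>\<^sup>+\<omega>. 0 \<partial>M)"
  proof (rule nn_integral_cong_AE)
    show "AE \<omega> in M. (\<integral>\<^sup>+c. indicator {s. E s} ((\<lambda>k. a k \<omega>)(0 := c)) \<partial>cgauss \<sigma>) = (0 :: ennreal)"
      using AE_sqrt_cancel
    proof eventually_elim
      case (elim \<omega>)
      define s where "s = (\<lambda>k. a k \<omega>)"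
      have s: "sqrt_cancel s" using elim by (simp add: s_def)
      let ?C = "{c. E (s(0 := c))}"
      let ?V = "dirichlet (s(0 := 0)) ` {z \<in> K. \<theta> * dirichlet (dlog (s(0 := 0))) z = 0}"
      have "(\<lambda>c. s(0 := c)) \<in> measurable borel (PiM UNIV (\<lambda>_. borel))"
        by (rule measurable_PiM_single') (auto simp: fun_upd_def)
      then have C [measurable]: "?C \<in> sets borel"
        using measurable_sets[of _ borel "PiM UNIV (\<lambda>_. borel)" "{s. E s}"]
        by (simp add: pred_def space_PiM vimage_def)
      \<comment> \<open>If c + g vanishes at z, then c = -g(z), where g is the series of
        \<open>s(0 := 0)\<close>.\<close>
      have "?C \<subseteq> uminus ` ?V"
      proof
        fix c assume "c \<in> ?C"
        then obtain z where z: "z \<in> K" "\<phi> (s(0 := c)) z = 0"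
          using E_imp sqrt_cancel_upd0[OF s] by blast
        have "norm (dirichlet (s(0 := c)) z) = 0" "norm (\<theta> * dirichlet (dlog s) z) = 0"
          using z(2) unfolding \<phi>_def dlog_upd0
          by (metis add_nonneg_eq_0_iff norm_ge_zero)+
        moreover have "Re z > 1/2" using z K by auto
        ultimately have "dirichlet s z - s 0 + c = 0" "dirichlet (s(0 := 0)) z = dirichlet s z - s 0"
          "\<theta> * dirichlet (dlog s) z = 0"
          using dirichlet_upd0[OF s, of z] by auto
        then have "- dirichlet (s(0 := 0)) z = c" "\<theta> * dirichlet (dlog s) z = 0"
          by (simp_all only: add_eq_0_iff)
        then show "c \<in> uminus ` ?V" using z by force
      qed
      moreover have "negligible (uminus ` ?V)"
        by (rule negligible_differentiable_image_negligible[OF order_refl neg[OF sqrt_cancel_upd0[OF s]]])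
          (auto intro!: linear_imp_differentiable_on linearI)
      ultimately have "emeasure (cgauss \<sigma>) ?C = 0"
        using cgauss_negligible[OF \<sigma> C] negligible_subset by blast
      moreover have "(\<integral>\<^sup>+c. indicator {s. E s} (s(0 := c)) \<partial>cgauss \<sigma>) = (\<integral>\<^sup>+c. indicator ?C c \<partial>cgauss \<sigma>)"
        by (intro nn_integral_cong) (auto split: split_indicator)
      ultimately show ?case
        using nn_integral_indicator[of ?C "cgauss \<sigma>"] C by (simp add: s_def)
    qed
  qed
  finally have "(\<integral>\<^sup>+\<omega>. indicator {s. E s} (\<lambda>k. a k \<omega>) \<partial>M) = 0" by simp
  then have "AE \<omega> in M. indicator {s. E s} (\<lambda>k. a k \<omega>) = (0 :: ennreal)"
    by (subst (asm) nn_integral_0_iff_AE) (auto simp: pred_def)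
  then show ?thesis using AE_sqrt_cancel
  proof eventually_elim
    case (elim \<omega>)
    have "\<phi> (\<lambda>k. a k \<omega>) z \<noteq> 0" if "z \<in> K" for z
      using elim imp_E[OF that] by (auto split: split_indicator_asm)
    then show ?case unfolding \<phi>_def by force
  qed
qed

end

lemma holomorphic_dirichlet_dlog:
  assumes "sqrt_cancel s"
  shows "dirichlet (dlog s) holomorphic_on {z. Re z > 1/2}"
proof -
  have "deriv (dirichlet s) holomorphic_on {z. Re z > 1/2}"
    by (intro holomorphic_deriv holomorphic_dirichlet assms open_halfspace_Re_gt)
  then show ?thesis
    by (rule holomorphic_transform)
      (simp only: mem_Collect_eq DERIV_imp_deriv[OF has_field_derivative_dirichlet[OF assms]])
qed

context iid_gauss
begin

text \<open>The case \<theta> = 0: a differentiable map of the plane sends negligible sets to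
  negligible sets. It serves the boundary of the rectangle as well as single points.\<close>

lemma AE_nonzero_negligible:
  assumes K: "compact K" "K \<subseteq> {z. Re z > 1/2}" "negligible K"
  shows "AE \<omega> in M. \<forall>z\<in>K. dirichlet (\<lambda>k. a k \<omega>) z \<noteq> 0"
proof -
  have "AE \<omega> in M. \<forall>z\<in>K. \<not> (dirichlet (\<lambda>k. a k \<omega>) z = 0 \<and> 0 * dirichlet (dlog (\<lambda>k. a k \<omega>)) z = 0)"
  proof (rule AE_no_common_zero[OF K(1,2)])
    fix s assume s: "sqrt_cancel s"
    show "negligible (dirichlet s ` {z \<in> K. 0 * dirichlet (dlog s) z = 0})"
    proof (rule negligible_differentiable_image_negligible)
      show "dirichlet s differentiable_on {z \<in> K. 0 * dirichlet (dlog s) z = 0}"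
        unfolding differentiable_on_def
      proof
        fix z assume "z \<in> {z \<in> K. 0 * dirichlet (dlog s) z = 0}"
        then have "Re z > 1/2" using K by auto
        then show "dirichlet s differentiable (at z within {z \<in> K. 0 * dirichlet (dlog s) z = 0})"
          using has_field_derivative_dirichlet[OF s]
          by (meson differentiableI differentiable_at_withinI has_field_derivative_imp_has_derivative)
      qed
    qed (use K in auto)
    show "continuous_on K (dirichlet (dlog s))"
      using holomorphic_on_subset[OF holomorphic_dirichlet_dlog[OF s] K(2)]
      by (rule holomorphic_on_imp_continuous_on)
  qed
  then show ?thesis by simp
qed

text \<open>The case \<theta> = 1, where the critical values must be negligible. The zeros of f' in
  the compact K are finite in number unless f' is constant; a constant f' either has no zeros or is
  0, and then f takes a single value.\<close>

lemma AE_simple_zeros: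
  assumes K: "compact K" "K \<subseteq> {z. Re z > 1/2}"
  shows "AE \<omega> in M. \<forall>z\<in>K. dirichlet (\<lambda>k. a k \<omega>) z = 0 \<longrightarrow> dirichlet (dlog (\<lambda>k. a k \<omega>)) z \<noteq> 0"
proof -
  let ?H = "{z. Re z > 1/2}"
  have H: "open ?H" "connected ?H" "convex ?H"
    by (simp_all only: open_halfspace_Re_gt convex_halfspace_Re_gt convex_connected)
  have "AE \<omega> in M. \<forall>z\<in>K. \<not> (dirichlet (\<lambda>k. a k \<omega>) z = 0 \<and> 1 * dirichlet (dlog (\<lambda>k. a k \<omega>)) z = 0)"
  proof (rule AE_no_common_zero[OF K])
    fix s assume s: "sqrt_cancel s"
    let ?g = "dirichlet (dlog s)"
    have hol: "?g holomorphic_on ?H" by (rule holomorphic_dirichlet_dlog[OF s])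
    show "continuous_on K ?g"
      using holomorphic_on_subset[OF hol K(2)] by (rule holomorphic_on_imp_continuous_on)
    show "negligible (dirichlet s ` {z \<in> K. 1 * ?g z = 0})"
    proof (cases "?g constant_on ?H")
      case False
      then have "finite {z \<in> K. ?g z = 0}"
        using holomorphic_compact_finite_zeros[OF hol H(1,2) K] by simp
      then show ?thesis by (simp add: negligible_finite)
    next
      case True
      then obtain d where d: "\<And>z. z \<in> ?H \<Longrightarrow> ?g z = d" by (auto simp: constant_on_def)
      show ?thesis
      proof (cases "d = 0")
        case False
        then have "{z \<in> K. 1 * ?g z = 0} = {}" using d K by auto
        then show ?thesis by (simp only: image_empty negligible_empty)
      next
        case True
        have "\<exists>c. \<forall>z\<in>?H. dirichlet s z = c"
          using H(3)
        proof (rule has_field_derivative_zero_constant)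
          fix z assume "z \<in> ?H"
          then show "(dirichlet s has_field_derivative 0) (at z within ?H)"
            using has_field_derivative_dirichlet[OF s, of z] d[of z] True
            by (auto intro: has_field_derivative_at_within)
        qed
        then obtain c where "\<And>z. z \<in> ?H \<Longrightarrow> dirichlet s z = c" by blast
        then have "dirichlet s ` {z \<in> K. 1 * ?g z = 0} \<subseteq> {c}" using K by auto
        then show ?thesis by (rule negligible_subset[rotated]) simp
      qed
    qed
  qed
  then show ?thesis by simp
qed

text \<open>Meant for Y = |f'|, which satisfies \<open>Y0\<close> because f' does not contain the
  first coefficient. Given the rest, Y is constant and 1/|f| becomes 1/|c + w|, whose mean over c is
  bounded uniformly in w.\<close>

lemma nn_integral_div_dirichlet_le:
  assumes Y [measurable]: "Y \<in> borel_measurable (PiM UNIV (\<lambda>_. borel))"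
    and Y0: "\<And>s c. Y (s(0 := c)) = Y s" and z: "Re z > 1/2"
  shows "(\<integral>\<^sup>+\<omega>. Y (\<lambda>k. a k \<omega>) * ennreal (inverse (norm (dirichlet (\<lambda>k. a k \<omega>) z))) \<partial>M)
    \<le> ennreal ((1 + normal_density 0 \<sigma> 0 * 4)\<^sup>2) * (\<integral>\<^sup>+\<omega>. Y (\<lambda>k. a k \<omega>) \<partial>M)"
proof -
  let ?B = "ennreal ((1 + normal_density 0 \<sigma> 0 * 4)\<^sup>2)"
  have [measurable]: "(\<lambda>\<omega> k. a k \<omega>) \<in> measurable M (PiM UNIV (\<lambda>_. borel))"
    by (rule measurable_PiM_single') auto
  have "(\<integral>\<^sup>+\<omega>. Y (\<lambda>k. a k \<omega>) * ennreal (inverse (norm (dirichlet (\<lambda>k. a k \<omega>) z))) \<partial>M) =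
    (\<integral>\<^sup>+\<omega>. \<integral>\<^sup>+c. Y ((\<lambda>k. a k \<omega>)(0 := c)) *
       ennreal (inverse (norm (dirichlet ((\<lambda>k. a k \<omega>)(0 := c)) z))) \<partial>cgauss \<sigma> \<partial>M)"
    by (rule nn_integral_resample) measurable
  also have "\<dots> \<le> (\<integral>\<^sup>+\<omega>. ?B * Y (\<lambda>k. a k \<omega>) \<partial>M)"
  proof (rule nn_integral_mono_AE)
    show "AE \<omega> in M. (\<integral>\<^sup>+c. Y ((\<lambda>k. a k \<omega>)(0 := c)) *
       ennreal (inverse (norm (dirichlet ((\<lambda>k. a k \<omega>)(0 := c)) z))) \<partial>cgauss \<sigma>) \<le> ?B * Y (\<lambda>k. a k \<omega>)"
      using AE_sqrt_cancel
    proof eventually_elim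
      case (elim \<omega>)
      let ?w = "dirichlet (\<lambda>k. a k \<omega>) z - a 0 \<omega>"
      have "(\<integral>\<^sup>+c. Y ((\<lambda>k. a k \<omega>)(0 := c)) *
         ennreal (inverse (norm (dirichlet ((\<lambda>k. a k \<omega>)(0 := c)) z))) \<partial>cgauss \<sigma>) =
         (\<integral>\<^sup>+c. Y (\<lambda>k. a k \<omega>) * ennreal (inverse (norm (c + ?w))) \<partial>cgauss \<sigma>)"
        unfolding Y0 dirichlet_upd0[OF elim z] by (simp add: algebra_simps)
      also have "\<dots> = Y (\<lambda>k. a k \<omega>) * (\<integral>\<^sup>+c. ennreal (inverse (norm (c + ?w))) \<partial>cgauss \<sigma>)"
        by (rule nn_integral_cmult) auto
      also have "\<dots> \<le> Y (\<lambda>k. a k \<omega>) * ?B"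
        by (intro mult_left_mono cgauss_inverse_norm_bound \<sigma>) auto
      finally show ?case by (simp add: mult.commute)
    qed
  qed
  also have "\<dots> = ?B * (\<integral>\<^sup>+\<omega>. Y (\<lambda>k. a k \<omega>) \<partial>M)"
    by (rule nn_integral_cmult) measurable
  finally show ?thesis .
qed

end

section \<open>Orthogonality and characters\<close>

context iid_gauss
begin

lemma integral_a:
  fixes g :: "complex \<Rightarrow> 'b::{banach, second_countable_topology}"
  assumes [measurable]: "g \<in> borel_measurable borel"
  shows "expectation (\<lambda>\<omega>. g (a k \<omega>)) = (\<integral>c. g c \<partial>cgauss \<sigma>)"
    and "integrable M (\<lambda>\<omega>. g (a k \<omega>)) \<longleftrightarrow> integrable (cgauss \<sigma>) g"
  using integral_distr[OF a_measurable assms, of k] integrable_distr_eq[OF a_measurable assms, of k]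
  unfolding distr_a by simp_all

lemma integrable_a: "integrable M (a k)" and expectation_a: "expectation (a k) = 0"
proof -
  have "integrable (cgauss \<sigma>) (\<lambda>c. c)" "(\<integral>c. c \<partial>cgauss \<sigma>) = 0"
    using cgauss_mult_iexp[OF \<sigma>, of 0] by simp_all
  then show "integrable M (a k)" "expectation (a k) = 0"
    using integral_a[of "\<lambda>c. c" k, OF measurable_ident_sets[OF refl]] by metis+
qed

lemma expectation_a_cnj:
  "integrable M (\<lambda>\<omega>. a j \<omega> * cnj (a k \<omega>))"
  "expectation (\<lambda>\<omega>. a j \<omega> * cnj (a k \<omega>)) = (if j = k then of_real (2 * \<sigma>\<^sup>2) else 0)"
proof -
  have eq: "a k \<omega> * cnj (a k \<omega>) = of_real ((norm (a k \<omega>))\<^sup>2)" for \<omega>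
    by (rule complex_norm_square[symmetric])
  have kk: "integrable M (\<lambda>\<omega>. (norm (a k \<omega>))\<^sup>2)" "expectation (\<lambda>\<omega>. (norm (a k \<omega>))\<^sup>2) = 2 * \<sigma>\<^sup>2"
    using cgauss_norm_square[OF \<sigma>] integral_a[of "\<lambda>c. (norm c)\<^sup>2" k] by simp_all
  have jk: "integrable M (\<lambda>\<omega>. a j \<omega> * cnj (a k \<omega>)) \<and> expectation (\<lambda>\<omega>. a j \<omega> * cnj (a k \<omega>)) = 0" if "j \<noteq> k"
  proof -
    have "indep_var (PiM {j} (\<lambda>_. borel)) (\<lambda>\<omega>. restrict (\<lambda>i. a i \<omega>) {j}) (PiM {k} (\<lambda>_. borel)) (\<lambda>\<omega>. restrict (\<lambda>i. a i \<omega>) {k})"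
      using that by (intro indep_var_restrict[OF indep]) auto
    then have "indep_var borel ((\<lambda>f. f j) \<circ> (\<lambda>\<omega>. restrict (\<lambda>i. a i \<omega>) {j})) borel ((\<lambda>f. cnj (f k)) \<circ> (\<lambda>\<omega>. restrict (\<lambda>i. a i \<omega>) {k}))"
      using borel_measurable_continuous_onI[OF continuous_on_cnj[OF continuous_on_id]]
      by (intro indep_var_compose[rotated -1] measurable_compose[of "\<lambda>f. f k" _ borel cnj]) auto
    then have i: "indep_var borel (a j) borel (\<lambda>\<omega>. cnj (a k \<omega>))" by (simp add: comp_def)
    have c: "integrable M (\<lambda>\<omega>. cnj (a k \<omega>))" using integrable_a by simp
    show ?thesis
      using indep_var_integrable[OF i integrable_a c] indep_var_lebesgue_integral[OF i integrable_a c]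
      by (simp add: expectation_a)
  qed
  show "integrable M (\<lambda>\<omega>. a j \<omega> * cnj (a k \<omega>))"
  proof (cases "j = k")
    case True
    show ?thesis unfolding True eq complex_of_real_integrable_eq by (rule kk(1))
  qed (use jk in blast)
  show "expectation (\<lambda>\<omega>. a j \<omega> * cnj (a k \<omega>)) = (if j = k then of_real (2 * \<sigma>\<^sup>2) else 0)"
  proof (cases "j = k")
    case True
    show ?thesis unfolding True eq integral_complex_of_real kk(2) by simp
  qed (use jk in simp)
qed

lemma expectation_norm_sum_square:
  assumes "finite A"
  shows "integrable M (\<lambda>\<omega>. (norm (\<Sum>k\<in>A. a k \<omega> * w k))\<^sup>2)"
    and "expectation (\<lambda>\<omega>. (norm (\<Sum>k\<in>A. a k \<omega> * w k))\<^sup>2) = 2 * \<sigma>\<^sup>2 * (\<Sum>k\<in>A. (norm (w k))\<^sup>2)"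
proof -
  have eq: "complex_of_real ((norm (\<Sum>k\<in>A. a k \<omega> * w k))\<^sup>2) =
      (\<Sum>j\<in>A. \<Sum>k\<in>A. (w j * cnj (w k)) * (a j \<omega> * cnj (a k \<omega>)))" for \<omega>
    unfolding complex_norm_square cnj_sum sum_product by (simp add: mult_ac)
  have "integrable M (\<lambda>\<omega>. complex_of_real ((norm (\<Sum>k\<in>A. a k \<omega> * w k))\<^sup>2))"
    unfolding eq by (intro Bochner_Integration.integrable_sum integrable_mult_right expectation_a_cnj)
  then show "integrable M (\<lambda>\<omega>. (norm (\<Sum>k\<in>A. a k \<omega> * w k))\<^sup>2)"
    unfolding complex_of_real_integrable_eq .
  have "complex_of_real (expectation (\<lambda>\<omega>. (norm (\<Sum>k\<in>A. a k \<omega> * w k))\<^sup>2)) =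
      expectation (\<lambda>\<omega>. complex_of_real ((norm (\<Sum>k\<in>A. a k \<omega> * w k))\<^sup>2))"
    by (rule integral_complex_of_real[symmetric])
  also have "\<dots> = (\<Sum>j\<in>A. \<Sum>k\<in>A. (w j * cnj (w k)) * (if j = k then of_real (2 * \<sigma>\<^sup>2) else 0))"
    unfolding eq
    by (simp only: Bochner_Integration.integral_sum Bochner_Integration.integrable_sum
        integrable_mult_right expectation_a_cnj integral_mult_right_zero)
  also have "\<dots> = (\<Sum>j\<in>A. (w j * cnj (w j)) * of_real (2 * \<sigma>\<^sup>2))"
    using assms by (simp add: if_distrib sum.delta cong: if_cong)
  also have "\<dots> = of_real (2 * \<sigma>\<^sup>2 * (\<Sum>k\<in>A. (norm (w k))\<^sup>2))"
    by (simp add: complex_norm_square[symmetric] sum_distrib_left mult_ac)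
  finally show "expectation (\<lambda>\<omega>. (norm (\<Sum>k\<in>A. a k \<omega> * w k))\<^sup>2) = 2 * \<sigma>\<^sup>2 * (\<Sum>k\<in>A. (norm (w k))\<^sup>2)"
    by (simp only: of_real_eq_iff)
qed

text \<open>Fatou's lemma along the almost sure limit: each block from n to m + n has second moment
  at most the tail sum, by orthogonality, and the limit inherits the bound. At n = 0 it controls L
  itself.\<close>

lemma square_tail_bound:
  assumes w: "summable (\<lambda>k. (norm (w k))\<^sup>2)"
    and L [measurable]: "L \<in> borel_measurable M"
    and sums: "AE \<omega> in M. (\<lambda>k. a k \<omega> * w k) sums L \<omega>"
  shows "integrable M (\<lambda>\<omega>. (norm (L \<omega> - (\<Sum>k<n. a k \<omega> * w k)))\<^sup>2)"
    and "expectation (\<lambda>\<omega>. (norm (L \<omega> - (\<Sum>k<n. a k \<omega> * w k)))\<^sup>2) \<le> 2 * \<sigma>\<^sup>2 * (\<Sum>k. (norm (w (k + n)))\<^sup>2)"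
proof -
  let ?S = "\<lambda>n \<omega>. \<Sum>k<n. a k \<omega> * w k"
  let ?T = "2 * \<sigma>\<^sup>2 * (\<Sum>k. (norm (w (k + n)))\<^sup>2)"
  have w': "summable (\<lambda>k. (norm (w (k + n)))\<^sup>2)" by (rule summable_ignore_initial_segment[OF w])
  have T0: "?T \<ge> 0" using w' by (intro mult_nonneg_nonneg suminf_nonneg) auto
  have step: "(\<integral>\<^sup>+\<omega>. ennreal ((norm (?S (m + n) \<omega> - ?S n \<omega>))\<^sup>2) \<partial>M) \<le> ennreal ?T" for m
  proof -
    have eq: "?S (m + n) \<omega> - ?S n \<omega> = (\<Sum>k\<in>{n..<m+n}. a k \<omega> * w k)" for \<omega>
      by (subst sum_diff_nat_ivl[of 0 n "m + n", unfolded atLeast0LessThan, symmetric]) auto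
    have "(\<integral>\<^sup>+\<omega>. ennreal ((norm (?S (m + n) \<omega> - ?S n \<omega>))\<^sup>2) \<partial>M) =
        ennreal (2 * \<sigma>\<^sup>2 * (\<Sum>k\<in>{n..<m+n}. (norm (w k))\<^sup>2))"
      unfolding eq by (subst nn_integral_eq_integral)
        (auto simp: expectation_norm_sum_square)
    also have "(\<Sum>k\<in>{n..<m+n}. (norm (w k))\<^sup>2) = (\<Sum>k<m. (norm (w (k + n)))\<^sup>2)"
      using sum.shift_bounds_nat_ivl[of "\<lambda>k. (norm (w k))\<^sup>2" 0 n m] by (simp add: atLeast0LessThan)
    also have "ennreal (2 * \<sigma>\<^sup>2 * (\<Sum>k<m. (norm (w (k + n)))\<^sup>2)) \<le> ennreal ?T"
      using w' by (intro ennreal_leI mult_left_mono sum_le_suminf) auto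
    finally show ?thesis .
  qed
  have "(\<integral>\<^sup>+\<omega>. ennreal ((norm (L \<omega> - ?S n \<omega>))\<^sup>2) \<partial>M) =
      (\<integral>\<^sup>+\<omega>. liminf (\<lambda>m. ennreal ((norm (?S (m + n) \<omega> - ?S n \<omega>))\<^sup>2)) \<partial>M)"
  proof (rule nn_integral_cong_AE)
    show "AE \<omega> in M. ennreal ((norm (L \<omega> - ?S n \<omega>))\<^sup>2) = liminf (\<lambda>m. ennreal ((norm (?S (m + n) \<omega> - ?S n \<omega>))\<^sup>2))"
      using sums
    proof eventually_elim
      case (elim \<omega>)
      then have "(\<lambda>m. ?S (m + n) \<omega>) \<longlonglongrightarrow> L \<omega>"
        unfolding sums_def by (rule LIMSEQ_ignore_initial_segment)
      then have "(\<lambda>m. ennreal ((norm (?S (m + n) \<omega> - ?S n \<omega>))\<^sup>2)) \<longlonglongrightarrow> ennreal ((norm (L \<omega> - ?S n \<omega>))\<^sup>2)"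
        by (intro tendsto_intros)
      then show ?case by (rule lim_imp_Liminf[OF sequentially_bot, symmetric])
    qed
  qed
  also have "\<dots> \<le> liminf (\<lambda>m. \<integral>\<^sup>+\<omega>. ennreal ((norm (?S (m + n) \<omega> - ?S n \<omega>))\<^sup>2) \<partial>M)"
    by (rule nn_integral_liminf) measurable
  also have "\<dots> \<le> ennreal ?T"
  proof -
    have "liminf (\<lambda>m. \<integral>\<^sup>+\<omega>. ennreal ((norm (?S (m + n) \<omega> - ?S n \<omega>))\<^sup>2) \<partial>M) \<le> liminf (\<lambda>m. ennreal ?T)"
      by (intro Liminf_mono always_eventually allI step)
    then show ?thesis by (simp add: Liminf_const)
  qed
  finally have le: "(\<integral>\<^sup>+\<omega>. ennreal ((norm (L \<omega> - ?S n \<omega>))\<^sup>2) \<partial>M) \<le> ennreal ?T" .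
  show int: "integrable M (\<lambda>\<omega>. (norm (L \<omega> - ?S n \<omega>))\<^sup>2)"
    by (rule integrableI_nonneg) (use le in \<open>auto intro: le_less_trans\<close>)
  have "ennreal (expectation (\<lambda>\<omega>. (norm (L \<omega> - ?S n \<omega>))\<^sup>2)) \<le> ennreal ?T"
    using le by (subst (asm) nn_integral_eq_integral[OF int]) auto
  then show "expectation (\<lambda>\<omega>. (norm (L \<omega> - ?S n \<omega>))\<^sup>2) \<le> ?T"
    using T0 by (simp only: ennreal_le_iff)
qed

text \<open>Jensen's inequality in the guise of a nonnegative variance.\<close>

lemma expectation_norm_le_sqrt:
  fixes Y :: "'a \<Rightarrow> complex"
  assumes [measurable]: "Y \<in> borel_measurable M" and Y2: "integrable M (\<lambda>\<omega>. (norm (Y \<omega>))\<^sup>2)"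
  shows "integrable M Y" "expectation (\<lambda>\<omega>. norm (Y \<omega>)) \<le> sqrt (expectation (\<lambda>\<omega>. (norm (Y \<omega>))\<^sup>2))"
proof -
  have i: "integrable M (\<lambda>\<omega>. norm (Y \<omega>))"
    by (rule square_integrable_imp_integrable[OF _ Y2]) simp
  then show "integrable M Y" by (rule integrable_norm_cancel) simp
  have "variance (\<lambda>\<omega>. norm (Y \<omega>)) \<ge> 0" by (rule variance_positive)
  then have "(expectation (\<lambda>\<omega>. norm (Y \<omega>)))\<^sup>2 \<le> expectation (\<lambda>\<omega>. (norm (Y \<omega>))\<^sup>2)"
    using variance_eq[OF i Y2] by simp
  then show "expectation (\<lambda>\<omega>. norm (Y \<omega>)) \<le> sqrt (expectation (\<lambda>\<omega>. (norm (Y \<omega>))\<^sup>2))"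
    by (rule real_le_rsqrt)
qed

lemma expectation_tail_tendsto_0:
  assumes w: "summable (\<lambda>k. (norm (w k))\<^sup>2)"
    and L [measurable]: "L \<in> borel_measurable M"
    and sums: "AE \<omega> in M. (\<lambda>k. a k \<omega> * w k) sums L \<omega>"
  shows "(\<lambda>n. expectation (\<lambda>\<omega>. norm (L \<omega> - (\<Sum>k<n. a k \<omega> * w k)))) \<longlonglongrightarrow> 0"
proof (rule tendsto_sandwich)
  show "\<forall>\<^sub>F n in sequentially. 0 \<le> expectation (\<lambda>\<omega>. norm (L \<omega> - (\<Sum>k<n. a k \<omega> * w k)))" by simp
  have "expectation (\<lambda>\<omega>. norm (L \<omega> - (\<Sum>k<n. a k \<omega> * w k))) \<le> sqrt (2 * \<sigma>\<^sup>2 * (\<Sum>k. (norm (w (k + n)))\<^sup>2))" for n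
  proof -
    have "(\<lambda>\<omega>. L \<omega> - (\<Sum>k<n. a k \<omega> * w k)) \<in> borel_measurable M" by measurable
    from expectation_norm_le_sqrt(2)[OF this square_tail_bound(1)[OF assms, of n]]
    show ?thesis using real_sqrt_le_mono[OF square_tail_bound(2)[OF assms, of n]] by (rule order_trans)
  qed
  then show "\<forall>\<^sub>F n in sequentially. expectation (\<lambda>\<omega>. norm (L \<omega> - (\<Sum>k<n. a k \<omega> * w k))) \<le> sqrt (2 * \<sigma>\<^sup>2 * (\<Sum>k. (norm (w (k + n)))\<^sup>2))"
    by simp
  have "(\<lambda>n. sqrt (2 * \<sigma>\<^sup>2 * (\<Sum>k. (norm (w (k + n)))\<^sup>2))) \<longlonglongrightarrow> sqrt (2 * \<sigma>\<^sup>2 * 0)"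
    by (intro tendsto_intros suminf_exist_split2[OF w])
  then show "(\<lambda>n. sqrt (2 * \<sigma>\<^sup>2 * (\<Sum>k. (norm (w (k + n)))\<^sup>2))) \<longlonglongrightarrow> 0" by simp
qed simp

section \<open>Characters of Gaussian series\<close>

lemma iexp_Re_sum:
  "iexp (Re (cnj \<xi> * (\<Sum>k<n. a k \<omega> * u k))) = (\<Prod>k<n. iexp (Re (cnj (\<xi> * cnj (u k)) * a k \<omega>)))"
proof -
  have "Re (cnj \<xi> * (\<Sum>k<n. a k \<omega> * u k)) = (\<Sum>k<n. Re (cnj (\<xi> * cnj (u k)) * a k \<omega>))"
    unfolding sum_distrib_left Re_sum by (intro sum.cong) (auto simp: mult_ac)
  then show ?thesis by (simp only: of_real_sum sum_distrib_left exp_sum[OF finite_lessThan])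
qed

text \<open>The character of the sum factors over the independent coefficients, and only factor j
  carries the extra \<open>a j\<close>. The exponential on the right does not depend on j, so a
  combination with weights \<open>w j\<close> produces the covariance sum of
  \<open>w j * cnj (u j)\<close>.\<close>

lemma expectation_a_iexp_sum:
  assumes j: "j < n"
  shows "expectation (\<lambda>\<omega>. a j \<omega> * iexp (Re (cnj \<xi> * (\<Sum>k<n. a k \<omega> * u k)))) =
     \<i> * \<sigma>\<^sup>2 * \<xi> * cnj (u j) * of_real (exp (- (\<sigma>\<^sup>2 * (norm \<xi>)\<^sup>2 * (\<Sum>k<n. (norm (u k))\<^sup>2)) / 2))"
proof -
  let ?\<eta> = "\<lambda>k. \<xi> * cnj (u k)"
  let ?e = "\<lambda>k c. iexp (Re (cnj (?\<eta> k) * c))"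
  let ?Y = "\<lambda>k c. if k = j then c * ?e k c else ?e k c"
  let ?E = "\<lambda>k. complex_of_real (exp (- (\<sigma>\<^sup>2 * (norm (?\<eta> k))\<^sup>2) / 2))"
  have Ym: "(\<lambda>c. ?Y k c) \<in> borel_measurable borel" for k by (cases "k = j") auto
  have int: "integrable M (\<lambda>\<omega>. ?Y k (a k \<omega>))" for k
  proof (cases "k = j")
    case True
    then show ?thesis using cgauss_mult_iexp(1)[OF \<sigma>, of "?\<eta> j"] Ym[of j] integral_a(2)[of "?Y j" j] by simp
  next
    case False
    then show ?thesis by (auto intro!: integrable_const_bound[where B = 1])
  qed
  have E: "expectation (\<lambda>\<omega>. ?Y k (a k \<omega>)) = (if k = j then \<i> * \<sigma>\<^sup>2 * ?\<eta> k * ?E k else ?E k)" for k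
    unfolding integral_a(1)[OF Ym] using cgauss_mult_iexp(2)[OF \<sigma>, of "?\<eta> k"] cgauss_iexp[OF \<sigma>, of "?\<eta> k"]
    by (cases "k = j") (simp_all only: if_True if_False simp_thms)
  have split: "(\<Prod>k<n. if k = j then x k * y k else y k) = x j * (\<Prod>k<n. y k)" for x y :: "nat \<Rightarrow> complex"
  proof -
    have "(\<Prod>k<n. if k = j then x k * y k else y k) = (\<Prod>k<n. (if k = j then x k else 1) * y k)"
      by (intro prod.cong) auto
    then show ?thesis using j by (simp add: prod.distrib prod.delta)
  qed
  have "expectation (\<lambda>\<omega>. a j \<omega> * iexp (Re (cnj \<xi> * (\<Sum>k<n. a k \<omega> * u k)))) =
      expectation (\<lambda>\<omega>. \<Prod>k<n. ?Y k (a k \<omega>))"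
    unfolding iexp_Re_sum split[of "\<lambda>k. a k _" "\<lambda>k. ?e k (a k _)"] ..
  also have "\<dots> = (\<Prod>k<n. expectation (\<lambda>\<omega>. ?Y k (a k \<omega>)))"
  proof (rule indep_vars_lebesgue_integral)
    show "indep_vars (\<lambda>_. borel) (\<lambda>k \<omega>. ?Y k (a k \<omega>)) {..<n}"
      by (rule indep_vars_compose2[where Y = ?Y, OF indep_vars_subset[OF indep]]) (use Ym in auto)
  qed (use int in simp_all)
  also have "\<dots> = \<i> * \<sigma>\<^sup>2 * ?\<eta> j * (\<Prod>k<n. ?E k)"
    unfolding E by (rule split)
  also have "(\<Prod>k<n. ?E k) = of_real (exp (\<Sum>k<n. - (\<sigma>\<^sup>2 * (norm (?\<eta> k))\<^sup>2) / 2))"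
    by (simp only: of_real_prod exp_sum[OF finite_lessThan])
  also have "(\<Sum>k<n. - (\<sigma>\<^sup>2 * (norm (?\<eta> k))\<^sup>2) / 2) = - (\<sigma>\<^sup>2 * (norm \<xi>)\<^sup>2 * (\<Sum>k<n. (norm (u k))\<^sup>2)) / 2"
    by (simp add: norm_mult power_mult_distrib sum_distrib_left sum_negf sum_divide_distrib mult_ac)
  finally show ?thesis by (simp only: mult_ac)
qed

text \<open>A form of the independence of \<open>H\<close> and \<open>F\<close> that avoids joint distributions: uncorrelated, centred,
  jointly Gaussian variables are tested against the characters of the second one only.\<close>

lemma expectation_mult_iexp_eq_0:
  assumes w: "summable (\<lambda>k. (norm (w k))\<^sup>2)"
    and H [measurable]: "H \<in> borel_measurable M" and F [measurable]: "F \<in> borel_measurable M"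
    and sumsH: "AE \<omega> in M. (\<lambda>k. a k \<omega> * w k) sums H \<omega>"
    and sumsF: "AE \<omega> in M. (\<lambda>k. a k \<omega> * u k) sums F \<omega>"
    and orth: "(\<lambda>k. w k * cnj (u k)) sums 0"
  shows "expectation (\<lambda>\<omega>. H \<omega> * iexp (Re (cnj \<xi> * F \<omega>))) = 0"
proof -
  define Hn where "Hn n \<omega> = (\<Sum>k<n. a k \<omega> * w k)" for n \<omega>
  define e where "e n \<omega> = iexp (Re (cnj \<xi> * (\<Sum>k<n. a k \<omega> * u k)))" for n \<omega>
  define e' where "e' \<omega> = iexp (Re (cnj \<xi> * F \<omega>))" for \<omega>
  have [measurable]: "Hn n \<in> borel_measurable M" "e n \<in> borel_measurable M" "e' \<in> borel_measurable M" for n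
    unfolding Hn_def[abs_def] e_def[abs_def] e'_def[abs_def] by measurable
  have ne: "norm (e n \<omega>) = 1" "norm (e' \<omega>) = 1" for n \<omega>
    unfolding e_def e'_def by simp_all
  have Hint: "integrable M H"
    using expectation_norm_le_sqrt(1)[OF H] square_tail_bound(1)[OF w H sumsH, of 0] by simp
  have Hnint: "integrable M (Hn n)" for n
    unfolding Hn_def[abs_def] by (intro Bochner_Integration.integrable_sum integrable_mult_left integrable_a)
  have me: "integrable M (\<lambda>\<omega>. X \<omega> * e n \<omega>)" "integrable M (\<lambda>\<omega>. X \<omega> * e' \<omega>)" if "integrable M X" for X n
    using that by (auto intro!: Bochner_Integration.integrable_bound[OF that] simp: norm_mult ne)
  \<comment> \<open>H is split as (H - Hn) + Hn, with the character truncated at the same n so that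
    the exact formula applies to Hn. The first part vanishes in mean; the second is, up to a
    constant, the truncated covariance times a factor of modulus at most 1.\<close>
  have 1: "(\<lambda>n. expectation (\<lambda>\<omega>. (H \<omega> - Hn n \<omega>) * e n \<omega>)) \<longlonglongrightarrow> 0"
  proof (rule Lim_null_comparison)
    show "\<forall>\<^sub>F n in sequentially. norm (expectation (\<lambda>\<omega>. (H \<omega> - Hn n \<omega>) * e n \<omega>))
        \<le> expectation (\<lambda>\<omega>. norm (H \<omega> - Hn n \<omega>))"
    proof (rule always_eventually, rule allI)
      fix n
      show "norm (expectation (\<lambda>\<omega>. (H \<omega> - Hn n \<omega>) * e n \<omega>)) \<le> expectation (\<lambda>\<omega>. norm (H \<omega> - Hn n \<omega>))"
        using integral_norm_bound[of M "\<lambda>\<omega>. (H \<omega> - Hn n \<omega>) * e n \<omega>"] by (simp add: norm_mult ne)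
    qed
    show "(\<lambda>n. expectation (\<lambda>\<omega>. norm (H \<omega> - Hn n \<omega>))) \<longlonglongrightarrow> 0"
      unfolding Hn_def by (rule expectation_tail_tendsto_0[OF w H sumsH])
  qed
  have 2: "(\<lambda>n. expectation (\<lambda>\<omega>. H \<omega> * e n \<omega>)) \<longlonglongrightarrow> expectation (\<lambda>\<omega>. H \<omega> * e' \<omega>)"
  proof (rule integral_dominated_convergence[where w = "\<lambda>\<omega>. norm (H \<omega>)"])
    show "AE \<omega> in M. (\<lambda>n. H \<omega> * e n \<omega>) \<longlonglongrightarrow> H \<omega> * e' \<omega>"
      using sumsF
    proof eventually_elim
      case (elim \<omega>)
      then show ?case unfolding sums_def e_def e'_def by (intro tendsto_intros)
    qed
  qed (use Hint in \<open>auto simp: norm_mult ne\<close>)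
  have val: "expectation (\<lambda>\<omega>. Hn n \<omega> * e n \<omega>) = (\<i> * \<sigma>\<^sup>2 * \<xi>) * ((\<Sum>j<n. w j * cnj (u j)) *
       of_real (exp (- (\<sigma>\<^sup>2 * (norm \<xi>)\<^sup>2 * (\<Sum>k<n. (norm (u k))\<^sup>2)) / 2)))" for n
  proof -
    have "expectation (\<lambda>\<omega>. Hn n \<omega> * e n \<omega>) = expectation (\<lambda>\<omega>. \<Sum>j<n. w j * (a j \<omega> * e n \<omega>))"
      unfolding Hn_def sum_distrib_right by (simp only: mult_ac)
    also have "\<dots> = (\<Sum>j<n. w j * expectation (\<lambda>\<omega>. a j \<omega> * e n \<omega>))"
      using me(1)[OF integrable_a] by (subst Bochner_Integration.integral_sum) auto
    also have "\<dots> = (\<Sum>j<n. w j * (\<i> * \<sigma>\<^sup>2 * \<xi> * cnj (u j) *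
       of_real (exp (- (\<sigma>\<^sup>2 * (norm \<xi>)\<^sup>2 * (\<Sum>k<n. (norm (u k))\<^sup>2)) / 2))))"
      unfolding e_def by (intro sum.cong refl) (simp only: expectation_a_iexp_sum lessThan_iff)
    finally show ?thesis by (simp only: sum_distrib_left sum_distrib_right mult_ac)
  qed
  have 3: "(\<lambda>n. expectation (\<lambda>\<omega>. Hn n \<omega> * e n \<omega>)) \<longlonglongrightarrow> 0"
  proof -
    have "(\<lambda>n. (\<Sum>j<n. w j * cnj (u j)) *
       of_real (exp (- (\<sigma>\<^sup>2 * (norm \<xi>)\<^sup>2 * (\<Sum>k<n. (norm (u k))\<^sup>2)) / 2))) \<longlonglongrightarrow> 0"
    proof (rule Lim_null_comparison)
      show "(\<lambda>n. norm (\<Sum>j<n. w j * cnj (u j))) \<longlonglongrightarrow> 0"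
        using orth unfolding sums_def by (rule tendsto_norm_zero)
      show "\<forall>\<^sub>F n in sequentially. norm ((\<Sum>j<n. w j * cnj (u j)) *
         complex_of_real (exp (- (\<sigma>\<^sup>2 * (norm \<xi>)\<^sup>2 * (\<Sum>k<n. (norm (u k))\<^sup>2)) / 2))) \<le> norm (\<Sum>j<n. w j * cnj (u j))"
        by (intro always_eventually allI)
          (auto simp: norm_mult intro!: mult_left_le sum_nonneg mult_nonneg_nonneg)
    qed
    then show ?thesis unfolding val by (rule tendsto_mult_right_zero)
  qed
  have "expectation (\<lambda>\<omega>. (H \<omega> - Hn n \<omega>) * e n \<omega>) + expectation (\<lambda>\<omega>. Hn n \<omega> * e n \<omega>) = expectation (\<lambda>\<omega>. H \<omega> * e n \<omega>)" for n
    using me(1)[OF Hint, of n] me(1)[OF Hnint, of n n]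
    by (simp add: left_diff_distrib Bochner_Integration.integral_diff)
  with tendsto_add[OF 1 3] have "(\<lambda>n. expectation (\<lambda>\<omega>. H \<omega> * e n \<omega>)) \<longlonglongrightarrow> 0" by simp
  with 2 show ?thesis unfolding e'_def using LIMSEQ_unique by blast
qed

end

section \<open>The expected logarithmic derivative\<close>

text \<open>The Gaussian kernel is a superposition of characters, and the reciprocal is a superposition of
  Gaussian kernels; so orthogonality of \<open>H\<close> to all characters of \<open>F\<close> passes to the reciprocal of \<open>F\<close>.\<close>

lemma (in prob_space) expectation_mult_gauss_kernel_eq_0:
  fixes H F :: "'a \<Rightarrow> complex"
  assumes H: "integrable M H" and F [measurable]: "F \<in> borel_measurable M"
    and zero: "\<And>\<xi>. expectation (\<lambda>\<omega>. H \<omega> * iexp (Re (cnj \<xi> * F \<omega>))) = 0"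
    and t: "t > 0"
  shows "expectation (\<lambda>\<omega>. H \<omega> * (cnj (F \<omega>) * of_real (exp (- (t * (norm (F \<omega>))\<^sup>2))))) = 0"
proof -
  \<comment> \<open>With this parameter the characteristic function exp(-\<tau>^2 |F|^2 / 2) of
    \<open>cgauss \<tau>\<close> is the kernel exp(-t |F|^2). The extra factor z under the integral
    produces \<open>cnj (F \<omega>)\<close>.\<close>
  define \<tau> where "\<tau> = sqrt (2 * t)"
  have \<tau>: "\<tau> > 0" "\<tau>\<^sup>2 = 2 * t" using t by (auto simp: \<tau>_def)
  interpret C: prob_space "cgauss \<tau>" by (rule prob_space_cgauss[OF \<tau>(1)])
  interpret P: pair_prob_space "cgauss \<tau>" M ..
  have [measurable]: "H \<in> borel_measurable M" using H by simp
  let ?\<phi> = "\<lambda>z \<omega>. H \<omega> * (z * iexp (Re (F \<omega> * z)))"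
  have inner: "(\<integral>z. ?\<phi> z \<omega> \<partial>cgauss \<tau>) =
      (\<i> * \<tau>\<^sup>2) * (H \<omega> * (cnj (F \<omega>) * of_real (exp (- (t * (norm (F \<omega>))\<^sup>2)))))" for \<omega>
  proof -
    have "(\<integral>z. ?\<phi> z \<omega> \<partial>cgauss \<tau>) = H \<omega> * (\<integral>z. z * iexp (Re (cnj (cnj (F \<omega>)) * z)) \<partial>cgauss \<tau>)"
      by (simp only: integral_mult_right_zero complex_cnj_cnj)
    also have "\<dots> = H \<omega> * (\<i> * \<tau>\<^sup>2 * cnj (F \<omega>) * of_real (exp (- (\<tau>\<^sup>2 * (norm (cnj (F \<omega>)))\<^sup>2) / 2)))"
      by (simp only: cgauss_mult_iexp(2)[OF \<tau>(1)])
    also have "- (\<tau>\<^sup>2 * (norm (cnj (F \<omega>)))\<^sup>2) / 2 = - (t * (norm (F \<omega>))\<^sup>2)"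
      by (simp add: \<tau>)
    finally show ?thesis by (simp only: mult_ac)
  qed
  have Hn: "integrable M (\<lambda>\<omega>. norm (H \<omega>))" using H by simp
  have zi: "integrable (cgauss \<tau>) (\<lambda>z. norm z)"
    using integrable_norm[OF cgauss_mult_iexp(1)[OF \<tau>(1), of 0]] by simp
  have int: "integrable (cgauss \<tau> \<Otimes>\<^sub>M M) (case_prod ?\<phi>)"
  proof (rule P.Fubini_integrable)
    show "integrable (cgauss \<tau>) (\<lambda>z. \<integral>\<omega>. norm (case (z, \<omega>) of (z, \<omega>) \<Rightarrow> ?\<phi> z \<omega>) \<partial>M)"
      using zi by (simp add: norm_mult)
    show "AE z in cgauss \<tau>. integrable M (\<lambda>\<omega>. case (z, \<omega>) of (z, \<omega>) \<Rightarrow> ?\<phi> z \<omega>)"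
    proof (rule AE_I2)
      fix z
      have "integrable M (\<lambda>\<omega>. z * (H \<omega> * iexp (Re (F \<omega> * z))))"
        by (intro integrable_mult_right Bochner_Integration.integrable_bound[OF H]) (auto simp: norm_mult)
      then show "integrable M (\<lambda>\<omega>. case (z, \<omega>) of (z, \<omega>) \<Rightarrow> ?\<phi> z \<omega>)" by (simp add: mult_ac)
    qed
  qed measurable
  have "(\<integral>\<omega>. \<integral>z. ?\<phi> z \<omega> \<partial>cgauss \<tau> \<partial>M) = (\<integral>z. \<integral>\<omega>. ?\<phi> z \<omega> \<partial>M \<partial>cgauss \<tau>)"
    by (rule P.Fubini_integral[OF int])
  also have "\<dots> = (\<integral>z. 0 \<partial>cgauss \<tau>)"
  proof (intro Bochner_Integration.integral_cong refl)
    fix z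
    have "(\<integral>\<omega>. ?\<phi> z \<omega> \<partial>M) = (\<integral>\<omega>. z * (H \<omega> * iexp (Re (cnj (cnj z) * F \<omega>))) \<partial>M)"
      by (simp only: complex_cnj_cnj mult_ac)
    then show "(\<integral>\<omega>. ?\<phi> z \<omega> \<partial>M) = 0" by (simp only: integral_mult_right_zero zero mult_zero_right)
  qed
  finally have "(\<integral>\<omega>. \<integral>z. ?\<phi> z \<omega> \<partial>cgauss \<tau> \<partial>M) = 0"
    by (simp only: Bochner_Integration.integral_zero)
  then have "(\<i> * \<tau>\<^sup>2) * expectation (\<lambda>\<omega>. H \<omega> * (cnj (F \<omega>) * of_real (exp (- (t * (norm (F \<omega>))\<^sup>2))))) = 0"
    unfolding inner by (simp only: integral_mult_right_zero)
  then show ?thesis using \<tau> t by simp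
qed

lemma has_bochner_integral_exp_neg:
  assumes r: "r > (0::real)"
  shows "has_bochner_integral lborel (\<lambda>t. exp (- (t * r)) * indicator {0..} t) (1 / r)"
proof (rule has_bochner_integral_nn_integral)
  have "((\<lambda>t. exp (- (t * r))) has_integral exp (- r * 0) / r) {0..}"
    using has_integral_exp_minus_to_infinity[OF r, of 0] by (simp add: mult.commute)
  from nn_integral_has_integral_lebesgue'[OF _ this]
  show "(\<integral>\<^sup>+t. ennreal (exp (- (t * r)) * indicator {0..} t) \<partial>lborel) = ennreal (1 / r)"
    by (simp add: ennreal_mult' ennreal_indicator[symmetric])
qed (use r in auto)

lemma (in prob_space) expectation_div_eq_0:
  fixes H F :: "'a \<Rightarrow> complex"
  assumes H: "integrable M H" and F [measurable]: "F \<in> borel_measurable M"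
    and zero: "\<And>\<xi>. expectation (\<lambda>\<omega>. H \<omega> * iexp (Re (cnj \<xi> * F \<omega>))) = 0"
    and HF: "integrable M (\<lambda>\<omega>. H \<omega> / F \<omega>)"
  shows "expectation (\<lambda>\<omega>. H \<omega> / F \<omega>) = 0"
proof -
  interpret P: pair_sigma_finite M lborel
    by (simp add: pair_sigma_finite_def sigma_finite_measure_axioms lborel.sigma_finite_measure_axioms)
  have [measurable]: "H \<in> borel_measurable M" using H by simp
  let ?k = "\<lambda>\<omega> t. exp (- (t * (norm (F \<omega>))\<^sup>2)) * indicator {0..} t"
  \<comment> \<open>1/F = cnj F / |F|^2 is the integral of cnj F exp(-t |F|^2) over t \<ge> 0. The
    absolute value integrates to exactly |H/F|, so \<open>HF\<close> is the integrability that
    Fubini asks for. Where F is 0 both sides are 0, as x / 0 = 0.\<close>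
  let ?\<psi> = "\<lambda>\<omega> t. (H \<omega> * cnj (F \<omega>)) * of_real (?k \<omega> t)"
  have k: "integrable lborel (?k \<omega>)" "(\<integral>t. ?k \<omega> t \<partial>lborel) = 1 / (norm (F \<omega>))\<^sup>2" if "F \<omega> \<noteq> 0" for \<omega>
    using has_bochner_integral_exp_neg[of "(norm (F \<omega>))\<^sup>2"] that
    by (auto simp: has_bochner_integral_iff)
  have int\<psi>: "integrable lborel (?\<psi> \<omega>)" for \<omega>
  proof (cases "F \<omega> = 0")
    case False
    show ?thesis
      by (intro integrable_mult_right) (simp only: complex_of_real_integrable_eq k(1)[OF False])
  qed simp
  have \<psi>: "(\<integral>t. ?\<psi> \<omega> t \<partial>lborel) = H \<omega> / F \<omega>" for \<omega>
  proof (cases "F \<omega> = 0")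
    case False
    have "complex_of_real (norm (F \<omega>)) * of_real (norm (F \<omega>)) = F \<omega> * cnj (F \<omega>)"
      using complex_norm_square[of "F \<omega>"] by (simp add: power2_eq_square)
    then show ?thesis using False
      by (simp only: integral_mult_right_zero integral_complex_of_real k(2)[OF False])
        (simp add: power2_eq_square field_simps)
  qed simp
  have n\<psi>: "(\<integral>t. norm (?\<psi> \<omega> t) \<partial>lborel) = norm (H \<omega> / F \<omega>)" for \<omega>
  proof (cases "F \<omega> = 0")
    case False
    have nn: "norm (?\<psi> \<omega> t) = (norm (H \<omega>) * norm (F \<omega>)) * ?k \<omega> t" for t
      by (simp add: norm_mult)
    show ?thesis
      by (simp only: nn integral_mult_right_zero k(2)[OF False]) (simp add: norm_divide power2_eq_square)
  qed simp
  have int: "integrable (M \<Otimes>\<^sub>M lborel) (case_prod ?\<psi>)"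
  proof (rule P.Fubini_integrable)
    show "integrable M (\<lambda>\<omega>. \<integral>t. norm (case (\<omega>, t) of (\<omega>, t) \<Rightarrow> ?\<psi> \<omega> t) \<partial>lborel)"
      unfolding prod.case n\<psi> using HF by (rule integrable_norm)
    show "AE \<omega> in M. integrable lborel (\<lambda>t. case (\<omega>, t) of (\<omega>, t) \<Rightarrow> ?\<psi> \<omega> t)"
      unfolding prod.case using int\<psi> by (intro AE_I2)
    have [measurable]: "cnj \<in> borel_measurable borel"
      by (intro borel_measurable_continuous_onI continuous_intros)
    have [measurable]: "(indicator {0..} :: real \<Rightarrow> real) \<in> borel_measurable lborel" by simp
    have [measurable]: "(\<lambda>p. exp (- (snd p * (norm (F (fst p)))\<^sup>2))) \<in> borel_measurable (M \<Otimes>\<^sub>M lborel)"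
      by measurable
    show "case_prod ?\<psi> \<in> borel_measurable (M \<Otimes>\<^sub>M lborel)"
      unfolding split_beta' by measurable
  qed
  have "expectation (\<lambda>\<omega>. H \<omega> / F \<omega>) = (\<integral>\<omega>. \<integral>t. ?\<psi> \<omega> t \<partial>lborel \<partial>M)"
    unfolding \<psi> ..
  also have "\<dots> = (\<integral>t. \<integral>\<omega>. ?\<psi> \<omega> t \<partial>M \<partial>lborel)"
    by (rule P.Fubini_integral[OF int, symmetric])
  also have "\<dots> = 0"
  proof (rule integral_eq_zero_AE)
    show "AE t in lborel. (\<integral>\<omega>. ?\<psi> \<omega> t \<partial>M) = 0"
      using AE_lborel_singleton[of "0::real"]
    proof eventually_elim
      case (elim t)
      show ?case
      proof (cases "t > 0")
        case True
        then show ?thesis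
          using expectation_mult_gauss_kernel_eq_0[OF H F zero True] by (simp add: mult.assoc)
      qed (use elim in simp)
    qed
  qed
  finally show ?thesis .
qed

context iid_gauss
begin

text \<open>The first factor bounds the mean of 1/|f| over the first coefficient; the second bounds
  the L^2 norm of f' at real part x.\<close>

definition log_deriv_bound :: "real \<Rightarrow> real" where
  "log_deriv_bound x = (1 + normal_density 0 \<sigma> 0 * 4)\<^sup>2 *
     sqrt (2 * \<sigma>\<^sup>2 * (\<Sum>k. ln (real (Suc k)) ^ 2 / real (Suc k) powr (2 * x)))"

text \<open>With c as in \<open>?c\<close>, H = f' - c f is uncorrelated with f, hence orthogonal to
  all characters of f, which gives E(H/f) = 0, that is E(f'/f) = c. The bound is proved first
  because it supplies the integrability of f'/f.\<close>

lemma log_deriv_dirichlet: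
  assumes z: "Re z > 1/2"
  defines "f \<equiv> \<lambda>\<omega>. dirichlet (\<lambda>k. a k \<omega>) z" and "f' \<equiv> \<lambda>\<omega>. dirichlet (dlog (\<lambda>k. a k \<omega>)) z"
  shows nn_integral_log_deriv_le:
      "(\<integral>\<^sup>+\<omega>. ennreal (norm (f' \<omega> / f \<omega>)) \<partial>M) \<le> ennreal (log_deriv_bound (Re z))"
    and expectation_log_deriv:
      "expectation (\<lambda>\<omega>. f' \<omega> / f \<omega>) = of_real (deriv riemann_zeta (2 * Re z) / riemann_zeta (2 * Re z))"
proof -
  \<comment> \<open>f and f' are the Gaussian series with weights u and v, and r = |u|^2 is the
    general term of \<zeta>(2 Re z).\<close>
  define u where "u k = 1 / (of_nat (Suc k) :: complex) powr z" for k
  define v where "v k = - (of_real (ln (real (Suc k))) * u k)" for k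
  define r where "r k = 1 / real (Suc k) powr (2 * Re z)" for k
  let ?x = "2 * Re z"
  let ?c = "deriv riemann_zeta ?x / riemann_zeta ?x"
  have x: "?x > 1" using z by simp
  have [measurable]: "f \<in> borel_measurable M" "f' \<in> borel_measurable M"
    unfolding f_def f'_def by measurable
  have uu: "u k * cnj (u k) = of_real (r k)" for k
  proof -
    have "norm (u k) = 1 / real (Suc k) powr Re z"
      unfolding u_def norm_divide using norm_of_nat_powr[of "Suc k" z] by simp
    then have "(norm (u k))\<^sup>2 = r k"
      by (simp add: r_def power_divide power2_eq_square powr_add[symmetric])
    then show ?thesis by (simp add: complex_norm_square[symmetric])
  qed
  have nu: "(norm (u k))\<^sup>2 = r k" for k
    using uu[of k] by (simp only: complex_norm_square[symmetric] of_real_eq_iff)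
  have summ: "summable (\<lambda>k. ln (real (Suc k)) ^ p * r k)" for p
    using summable_ln_powr[OF x, of p] by (simp add: r_def)
  have sumf: "AE \<omega> in M. (\<lambda>k. a k \<omega> * u k) sums f \<omega>"
    using AE_sqrt_cancel
  proof eventually_elim
    case (elim \<omega>)
    from dirichlet_sums[OF elim z] show ?case by (simp add: u_def f_def)
  qed
  have sumf': "AE \<omega> in M. (\<lambda>k. a k \<omega> * v k) sums f' \<omega>"
    using AE_sqrt_cancel
  proof eventually_elim
    case (elim \<omega>)
    from dirichlet_dlog_sums[OF elim z] show ?case
      by (simp add: u_def v_def f'_def dlog_def mult_ac)
  qed
  have nv: "(norm (v k))\<^sup>2 = ln (real (Suc k)) ^ 2 * r k" for k
    unfolding v_def norm_minus_cancel norm_mult power_mult_distrib nu by simp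
  have v2: "summable (\<lambda>k. (norm (v k))\<^sup>2)" unfolding nv by (rule summ)
  note f'_sq = square_tail_bound[OF v2 _ sumf', of 0, simplified]
  have f'_int: "integrable M f'"
    and "expectation (\<lambda>\<omega>. norm (f' \<omega>)) \<le> sqrt (expectation (\<lambda>\<omega>. (norm (f' \<omega>))\<^sup>2))"
    using expectation_norm_le_sqrt[OF _ f'_sq(1)] by simp_all
  note this(2)
  also have "sqrt (expectation (\<lambda>\<omega>. (norm (f' \<omega>))\<^sup>2)) \<le> sqrt (2 * \<sigma>\<^sup>2 * (\<Sum>k. ln (real (Suc k)) ^ 2 * r k))"
    using f'_sq(2) unfolding nv by (intro real_sqrt_le_mono) simp
  finally have f'_le: "expectation (\<lambda>\<omega>. norm (f' \<omega>)) \<le> sqrt (2 * \<sigma>\<^sup>2 * (\<Sum>k. ln (real (Suc k)) ^ 2 * r k))" .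
  have "(\<integral>\<^sup>+\<omega>. ennreal (norm (f' \<omega> / f \<omega>)) \<partial>M) =
     (\<integral>\<^sup>+\<omega>. ennreal (norm (f' \<omega>)) * ennreal (inverse (norm (f \<omega>))) \<partial>M)"
    by (intro nn_integral_cong) (simp add: divide_inverse norm_mult norm_inverse ennreal_mult[symmetric])
  also have "\<dots> \<le> ennreal ((1 + normal_density 0 \<sigma> 0 * 4)\<^sup>2) * (\<integral>\<^sup>+\<omega>. ennreal (norm (f' \<omega>)) \<partial>M)"
    unfolding f_def f'_def
    by (rule nn_integral_div_dirichlet_le[where Y = "\<lambda>s. ennreal (norm (dirichlet (dlog s) z))", OF _ _ z]) auto
  also have "(\<integral>\<^sup>+\<omega>. ennreal (norm (f' \<omega>)) \<partial>M) = ennreal (expectation (\<lambda>\<omega>. norm (f' \<omega>)))"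
    using f'_int by (intro nn_integral_eq_integral) auto
  also have "ennreal ((1 + normal_density 0 \<sigma> 0 * 4)\<^sup>2) * \<dots> \<le>
     ennreal ((1 + normal_density 0 \<sigma> 0 * 4)\<^sup>2) * ennreal (sqrt (2 * \<sigma>\<^sup>2 * (\<Sum>k. ln (real (Suc k)) ^ 2 * r k)))"
    by (intro mult_left_mono ennreal_leI f'_le) auto
  also have "\<dots> = ennreal (log_deriv_bound (Re z))"
    by (subst ennreal_mult[symmetric])
      (auto simp: log_deriv_bound_def r_def intro!: mult_nonneg_nonneg suminf_nonneg summ[of 2, unfolded r_def, simplified])
  finally show bound: "(\<integral>\<^sup>+\<omega>. ennreal (norm (f' \<omega> / f \<omega>)) \<partial>M) \<le> ennreal (log_deriv_bound (Re z))" .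
  have q_int: "integrable M (\<lambda>\<omega>. f' \<omega> / f \<omega>)"
    by (rule integrableI_bounded) (use bound in \<open>auto intro: le_less_trans\<close>)
  \<comment> \<open>The identity H/f = f'/f - c may fail where f = 0, because division by 0 yields
    0.\<close>
  have f_ne: "AE \<omega> in M. f \<omega> \<noteq> 0"
    using AE_nonzero_negligible[of "{z}"] z by (simp add: f_def)
  define w where "w k = v k - ?c * u k" for k
  define H where "H \<omega> = f' \<omega> - ?c * f \<omega>" for \<omega>
  have [measurable]: "H \<in> borel_measurable M" unfolding H_def by measurable
  have wu: "w k = - of_real (ln (real (Suc k)) + ?c) * u k" for k
    by (simp add: w_def v_def algebra_simps)
  have nw: "(norm (w k))\<^sup>2 = (ln (real (Suc k)) + ?c)\<^sup>2 * r k" for k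
    unfolding wu norm_mult power_mult_distrib nu norm_minus_cancel norm_of_real power2_abs ..
  have w2: "summable (\<lambda>k. (norm (w k))\<^sup>2)"
  proof -
    have "summable (\<lambda>k. ln (real (Suc k)) ^ 2 * r k + (2 * ?c) * (ln (real (Suc k)) ^ 1 * r k) + ?c\<^sup>2 * (ln (real (Suc k)) ^ 0 * r k))"
      by (intro summable_add summable_mult summ)
    then show ?thesis unfolding nw by (simp add: power2_eq_square algebra_simps)
  qed
  have sumH: "AE \<omega> in M. (\<lambda>k. a k \<omega> * w k) sums H \<omega>"
    using sumf sumf'
  proof eventually_elim
    case (elim \<omega>)
    from sums_diff[OF elim(2) sums_mult[OF elim(1), of ?c]]
    show ?case by (simp only: w_def H_def right_diff_distrib mult_ac)
  qed
  \<comment> \<open>The sum is \<zeta>'(2 Re z) - c \<zeta>(2 Re z), which vanishes by the choice of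
    c; the powers 1 and 0 of the logarithm bring both series under \<open>summ\<close>.\<close>
  have orth: "(\<lambda>k. w k * cnj (u k)) sums 0"
  proof -
    have eq: "w k * cnj (u k) = - of_real (ln (real (Suc k)) ^ 1 * r k + ?c * (ln (real (Suc k)) ^ 0 * r k))" for k
    proof -
      have "w k * cnj (u k) = - of_real (ln (real (Suc k)) + ?c) * (u k * cnj (u k))"
        unfolding wu by (simp only: mult.assoc)
      then show ?thesis unfolding uu by (simp add: algebra_simps)
    qed
    have "(\<lambda>k. ln (real (Suc k)) ^ 1 * r k + ?c * (ln (real (Suc k)) ^ 0 * r k)) sums
        ((\<Sum>k. ln (real (Suc k)) ^ 1 * r k) + ?c * (\<Sum>k. ln (real (Suc k)) ^ 0 * r k))"
      by (intro sums_add sums_mult summable_sums summ)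
    also have "(\<Sum>k. ln (real (Suc k)) ^ 1 * r k) = - deriv riemann_zeta ?x"
      unfolding deriv_riemann_zeta[OF x] by (simp add: r_def)
    also have "(\<Sum>k. ln (real (Suc k)) ^ 0 * r k) = riemann_zeta ?x"
      unfolding riemann_zeta_def by (simp add: r_def)
    also have "- deriv riemann_zeta ?x + ?c * riemann_zeta ?x = 0"
      using riemann_zeta_ge_1[OF x] by simp
    finally have "(\<lambda>k. - complex_of_real (ln (real (Suc k)) ^ 1 * r k + ?c * (ln (real (Suc k)) ^ 0 * r k))) sums (- of_real 0)"
      by (intro sums_minus sums_of_real)
    then show ?thesis unfolding eq by simp
  qed
  have HF: "AE \<omega> in M. H \<omega> / f \<omega> = f' \<omega> / f \<omega> - of_real ?c"
    using f_ne by eventually_elim (simp add: H_def diff_divide_distrib)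
  have diff_int: "integrable M (\<lambda>\<omega>. f' \<omega> / f \<omega> - of_real ?c)"
    using q_int by (intro Bochner_Integration.integrable_diff) auto
  have "expectation (\<lambda>\<omega>. H \<omega> / f \<omega>) = 0"
  proof (rule expectation_div_eq_0)
    show "integrable M H"
      using expectation_norm_le_sqrt(1)[OF _ square_tail_bound(1)[OF w2 _ sumH, of 0]] by simp
    show "expectation (\<lambda>\<omega>. H \<omega> * iexp (Re (cnj \<xi> * f \<omega>))) = 0" for \<xi>
      by (rule expectation_mult_iexp_eq_0[OF w2 _ _ sumH sumf orth]) measurable
    show "integrable M (\<lambda>\<omega>. H \<omega> / f \<omega>)"
      by (subst integrable_cong_AE[OF _ _ HF]) (use diff_int in auto)
  qed measurable
  moreover have "expectation (\<lambda>\<omega>. H \<omega> / f \<omega>) = expectation (\<lambda>\<omega>. f' \<omega> / f \<omega> - of_real ?c)"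
    by (rule integral_cong_AE[OF _ _ HF]) measurable
  moreover have "\<dots> = expectation (\<lambda>\<omega>. f' \<omega> / f \<omega>) - of_real ?c"
    using q_int by (subst Bochner_Integration.integral_diff) (auto simp: prob_space)
  ultimately show "expectation (\<lambda>\<omega>. f' \<omega> / f \<omega>) = of_real ?c" by simp
qed

end

section \<open>The expected number of zeros\<close>

text \<open>Contour integrals are gauge integrals over [0, 1]; the Lebesgue form is the one to which
  Fubini applies.\<close>

lemma contour_integral_linepath_lborel:
  assumes "continuous_on (closed_segment p p') q"
  shows "contour_integral (linepath p p') q =
    (\<integral>t. indicator {0..1} t *\<^sub>R q (linepath p p' t) \<partial>lborel) * (p' - p)"
proof -
  have cont: "continuous_on {0..1} (\<lambda>t. q (linepath p p' t))"
    using assms by (intro continuous_on_compose2[OF assms] continuous_intros) (auto simp: linepath_in_path)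
  note s = set_borel_integral_eq_integral[OF borel_integrable_atLeastAtMost'[OF cont]]
  have "((\<lambda>t. q (linepath p p' t)) has_integral (LINT t:{0..1}|lborel. q (linepath p p' t))) {0..1}"
    unfolding s(2) by (rule integrable_integral[OF s(1)])
  then have "((\<lambda>t. q (linepath p p' t) * (p' - p)) has_integral
      (LINT t:{0..1}|lborel. q (linepath p p' t)) * (p' - p)) {0..1}"
    by (rule has_integral_mult_left)
  then show ?thesis
    unfolding has_contour_integral_linepath[symmetric] set_lebesgue_integral_def
    by (rule contour_integral_unique)
qed

text \<open>The top and left sides are reversed, whence the minus signs: opposite sides then run in
  the same direction, so that in expectation the horizontal ones agree parameter by
  parameter.\<close>

lemma contour_integral_rectpath_sides:
  assumes ab: "Re p \<le> Re r" "Im p \<le> Im r" and q: "continuous_on (cbox p r - box p r) q"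
  defines "I \<equiv> \<lambda>u v. contour_integral (linepath u v) q"
    and "p' \<equiv> Complex (Re r) (Im p)" and "r' \<equiv> Complex (Re p) (Im r)"
  shows "contour_integral (rectpath p r) q = I p p' + I p' r - I r' r - I p r'"
    and "closed_segment p p' \<subseteq> cbox p r - box p r" "closed_segment p' r \<subseteq> cbox p r - box p r"
    "closed_segment r' r \<subseteq> cbox p r - box p r" "closed_segment p r' \<subseteq> cbox p r - box p r"
proof -
  have im: "path_image (rectpath p r) = cbox p r - box p r"
    using ab by (simp add: path_image_rectpath_cbox_minus_box)
  have rect: "rectpath p r = linepath p p' +++ linepath p' r +++ linepath r r' +++ linepath r' p"
    by (simp add: rectpath_def Let_def p'_def r'_def)
  have seg: "closed_segment p p' \<union> closed_segment p' r \<union> closed_segment r r' \<union> closed_segment r' p \<subseteq> cbox p r - box p r"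
    unfolding im[symmetric] rect by (simp add: path_image_join) blast
  then show sub: "closed_segment p p' \<subseteq> cbox p r - box p r" "closed_segment p' r \<subseteq> cbox p r - box p r"
    "closed_segment r' r \<subseteq> cbox p r - box p r" "closed_segment p r' \<subseteq> cbox p r - box p r"
    by (auto simp: closed_segment_commute)
  have ci: "q contour_integrable_on linepath u v" if "closed_segment u v \<subseteq> cbox p r - box p r" for u v
    by (rule contour_integrable_continuous_linepath[OF continuous_on_subset[OF q that]])
  have "contour_integral (rectpath p r) q = I p p' + I p' r + I r r' + I r' p"
    unfolding rect I_def using seg
    by (simp add: ci contour_integrable_joinI)
  moreover have "I r r' = - I r' r" "I r' p = - I p r'"
    unfolding I_def
    by (metis contour_integral_reversepath reversepath_linepath valid_path_linepath)+
  ultimately show "contour_integral (rectpath p r) q = I p p' + I p' r - I r' r - I p r'" by simp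
qed

context iid_gauss
begin

definition log_deriv :: "'a \<Rightarrow> complex \<Rightarrow> complex" where
  "log_deriv \<omega> z = dirichlet (dlog (\<lambda>k. a k \<omega>)) z / dirichlet (\<lambda>k. a k \<omega>) z"

text \<open>Defined for every \<omega>, also where f vanishes on the segment; for the sides of the
  rectangle it is almost surely the contour integral of f'/f.\<close>

definition side :: "complex \<Rightarrow> complex \<Rightarrow> 'a \<Rightarrow> complex" where
  "side u v \<omega> = (\<integral>t. indicator {0..1} t *\<^sub>R log_deriv \<omega> (linepath u v t) \<partial>lborel) * (v - u)"

lemma log_deriv_bound_antimono:
  assumes "1/2 < x" "x \<le> y" shows "log_deriv_bound y \<le> log_deriv_bound x"
proof -
  have "(\<Sum>k. ln (real (Suc k)) ^ 2 / real (Suc k) powr (2 * y)) \<le>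
      (\<Sum>k. ln (real (Suc k)) ^ 2 / real (Suc k) powr (2 * x))"
    using assms by (intro suminf_le summable_ln_powr divide_left_mono powr_mono) auto
  then show ?thesis
    unfolding log_deriv_bound_def by (intro mult_left_mono real_sqrt_le_mono) auto
qed

text \<open>Fubini over the segment and the probability space: on the segment Re z is at least the
  smaller real part x of the endpoints, so \<open>log_deriv_bound x\<close> dominates the mean of
  |f'/f| at each of its points.\<close>

lemma side_expectation:
  assumes u: "Re u > 1/2" and v: "Re v > 1/2"
  shows "integrable M (side u v)"
    and "expectation (side u v) = (\<integral>t. indicator {0..1} t *\<^sub>R
      complex_of_real (deriv riemann_zeta (2 * Re (linepath u v t)) / riemann_zeta (2 * Re (linepath u v t))) \<partial>lborel) * (v - u)"
proof -
  interpret P: pair_sigma_finite lborel M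
    by (simp add: pair_sigma_finite_def sigma_finite_measure_axioms lborel.sigma_finite_measure_axioms)
  let ?g = "\<lambda>t \<omega>. indicator {0..1} t *\<^sub>R log_deriv \<omega> (linepath u v t)"
  let ?R = "\<lambda>t. complex_of_real (deriv riemann_zeta (2 * Re (linepath u v t)) / riemann_zeta (2 * Re (linepath u v t)))"
  define x where "x = min (Re u) (Re v)"
  have x: "x > 1/2" using u v by (simp add: x_def)
  have Re: "Re (linepath u v t) \<ge> x" if "t \<in> {0..1}" for t
  proof -
    have "linepath u v t \<in> closed_segment u v" using that by (rule linepath_in_path)
    moreover have "closed_segment u v \<subseteq> {z. Re z \<ge> x}"
      by (rule closed_segment_subset) (auto simp: x_def convex_halfspace_Re_ge)
    ultimately show ?thesis by blast
  qed
  have [measurable]: "linepath u v \<in> borel_measurable borel"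
    by (intro borel_measurable_continuous_onI continuous_intros)
  have [measurable]: "(indicator {0..1} :: real \<Rightarrow> real) \<in> borel_measurable lborel" by simp
  have [measurable]: "(\<lambda>p. linepath u v (fst p)) \<in> borel_measurable (lborel \<Otimes>\<^sub>M M)" by measurable
  have [measurable]: "case_prod ?g \<in> borel_measurable (lborel \<Otimes>\<^sub>M M)"
    unfolding split_beta' log_deriv_def by measurable
  have "(\<integral>\<^sup>+p. ennreal (norm (case_prod ?g p)) \<partial>(lborel \<Otimes>\<^sub>M M)) = (\<integral>\<^sup>+t. \<integral>\<^sup>+\<omega>. ennreal (norm (?g t \<omega>)) \<partial>M \<partial>lborel)"
    by (subst nn_integral_fst[symmetric]) auto
  also have "\<dots> \<le> (\<integral>\<^sup>+t. ennreal (log_deriv_bound x) * indicator {0..1::real} t \<partial>lborel)"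
  proof (rule nn_integral_mono)
    fix t :: real
    show "(\<integral>\<^sup>+\<omega>. ennreal (norm (?g t \<omega>)) \<partial>M) \<le> ennreal (log_deriv_bound x) * indicator {0..1} t"
    proof (cases "t \<in> {0..1}")
      case True
      have "(\<integral>\<^sup>+\<omega>. ennreal (norm (?g t \<omega>)) \<partial>M) \<le> ennreal (log_deriv_bound (Re (linepath u v t)))"
        using nn_integral_log_deriv_le[of "linepath u v t"] Re[OF True] x True
        by (simp add: log_deriv_def)
      also have "\<dots> \<le> ennreal (log_deriv_bound x)"
        by (intro ennreal_leI log_deriv_bound_antimono x Re True)
      finally show ?thesis using True by simp
    qed simp
  qed
  also have "\<dots> < \<infinity>" by (subst nn_integral_cmult_indicator) auto
  finally have int: "integrable (lborel \<Otimes>\<^sub>M M) (case_prod ?g)"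
    by (intro integrableI_bounded) auto
  show "integrable M (side u v)"
    unfolding side_def[abs_def] using P.integrable_snd[OF int] by (rule integrable_mult_left)
  have "expectation (side u v) = (\<integral>\<omega>. \<integral>t. ?g t \<omega> \<partial>lborel \<partial>M) * (v - u)"
    unfolding side_def[abs_def] by (rule integral_mult_left_zero)
  also have "(\<integral>\<omega>. \<integral>t. ?g t \<omega> \<partial>lborel \<partial>M) = (\<integral>t. \<integral>\<omega>. ?g t \<omega> \<partial>M \<partial>lborel)"
    by (rule P.Fubini_integral[OF int])
  also have "\<dots> = (\<integral>t. indicator {0..1} t *\<^sub>R ?R t \<partial>lborel)"
  proof (intro Bochner_Integration.integral_cong refl)
    fix t :: real
    show "(\<integral>\<omega>. ?g t \<omega> \<partial>M) = indicator {0..1} t *\<^sub>R ?R t"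
    proof (cases "t \<in> {0..1}")
      case True
      then show ?thesis
        using expectation_log_deriv[of "linepath u v t"] Re[OF True] x by (simp add: log_deriv_def)
    qed simp
  qed
  finally show "expectation (side u v) = (\<integral>t. indicator {0..1} t *\<^sub>R ?R t \<partial>lborel) * (v - u)" .
qed

lemma side_expectation_vertical:
  assumes "x > 1/2"
  shows "expectation (side (Complex x y) (Complex x y')) =
    of_real (deriv riemann_zeta (2 * x) / riemann_zeta (2 * x)) * (\<i> * of_real (y' - y))"
proof -
  have Re: "Re (linepath (Complex x y) (Complex x y') t) = x" for t
    by (simp add: linepath_def algebra_simps)
  have "Complex x y' - Complex x y = \<i> * of_real (y' - y)"
    by (simp add: complex_eq_iff)
  then show ?thesis
    using side_expectation(2)[of "Complex x y" "Complex x y'"] assms by (simp add: Re)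
qed

text \<open>Almost surely the boundary is free of zeros and those inside are simple, so the argument
  principle counts them. The natural number n links the extended real count to the complex
  integrals.\<close>

lemma AE_count_zeros:
  assumes x: "1/2 < x1" "x1 < x2" and y: "y1 < y2"
  defines "p \<equiv> Complex x1 y1" and "r \<equiv> Complex x2 y2"
    and "p' \<equiv> Complex x2 y1" and "r' \<equiv> Complex x1 y2"
  shows "AE \<omega> in M. \<exists>n::nat. zero_count (rand_dirichlet a \<omega>) (open_rect x1 x2 y1 y2) = of_nat n \<and>
     side p p' \<omega> + side p' r \<omega> - side r' r \<omega> - side p r' \<omega> = 2 * pi * \<i> * of_nat n"
proof -
  let ?H = "{z. Re z > 1/2}"
  have K: "cbox p r \<subseteq> ?H" using x by (auto simp: in_cbox_complex_iff p_def)
  have "AE \<omega> in M. \<forall>z\<in>cbox p r - box p r. dirichlet (\<lambda>k. a k \<omega>) z \<noteq> 0"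
    using K by (intro AE_nonzero_negligible negligible_frontier_interval compact_diff) auto
  moreover have "AE \<omega> in M. \<forall>z\<in>cbox p r. dirichlet (\<lambda>k. a k \<omega>) z = 0 \<longrightarrow> dirichlet (dlog (\<lambda>k. a k \<omega>)) z \<noteq> 0"
    using K by (intro AE_simple_zeros) auto
  ultimately show ?thesis using AE_sqrt_cancel
  proof eventually_elim
    case (elim \<omega>)
    let ?f = "dirichlet (\<lambda>k. a k \<omega>)"
    note bd = elim(1) and simple = elim(2) and s = elim(3)
    have deriv: "deriv ?f z = dirichlet (dlog (\<lambda>k. a k \<omega>)) z" if "z \<in> ?H" for z
      using has_field_derivative_dirichlet[OF s, of z] that by (auto intro: DERIV_imp_deriv)
    have boxsub: "box p r \<subseteq> cbox p r" by (rule box_subset_cbox)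
    let ?n = "card {z \<in> box p r. ?f z = 0}"
    have cnt: "finite {z \<in> box p r. ?f z = 0} \<and>
      contour_integral (rectpath p r) (\<lambda>z. deriv ?f z / ?f z) = 2 * pi * \<i> * ?n"
    proof (intro conjI)
      \<comment> \<open>An outer rectangle still inside the half-plane: its left edge is midway
        between 1/2 and x1, the other edges are moved out by 1.\<close>
      let ?a = "Complex ((1/2 + x1) / 2) (y1 - 1)" and ?b = "Complex (x2 + 1) (y2 + 1)"
      have 1: "cbox ?a ?b \<subseteq> ?H" using x by (auto simp: in_cbox_complex_iff)
      have 2: "cbox p r \<subseteq> box ?a ?b"
        using x by (auto simp: in_cbox_complex_iff in_box_complex_iff p_def r_def field_simps)
      have c: "connected ?H" by (intro convex_connected convex_halfspace_Re_gt)
      have ab: "Re p < Re r" "Im p < Im r" using x y by (auto simp: p_def r_def)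
      have simple': "deriv ?f z \<noteq> 0" if "z \<in> box p r" "?f z = 0" for z
        using simple deriv[of z] that boxsub K by (metis subsetD)
      note C = count_simple_zeros_rectpath[OF holomorphic_dirichlet[OF s] open_halfspace_Re_gt c 1 2 ab _ simple']
      show "finite {z \<in> box p r. ?f z = 0}" by (rule C(1)) (use bd in auto)
      show "contour_integral (rectpath p r) (\<lambda>z. deriv ?f z / ?f z) = 2 * pi * \<i> * ?n"
        by (rule C(2)) (use bd in auto)
    qed
    have "open_rect x1 x2 y1 y2 = box p r"
      by (auto simp: open_rect_def in_box_complex_iff p_def r_def)
    moreover have "rand_dirichlet a \<omega> = ?f" by (simp add: rand_dirichlet_def dirichlet_def fun_eq_iff)
    ultimately have zc: "zero_count (rand_dirichlet a \<omega>) (open_rect x1 x2 y1 y2) = of_nat ?n"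
      using cnt by (simp add: zero_count_def)
    have im: "path_image (rectpath p r) = cbox p r - box p r"
      using x y by (intro path_image_rectpath_cbox_minus_box) (auto simp: p_def r_def)
    have "contour_integral (rectpath p r) (\<lambda>z. deriv ?f z / ?f z) = contour_integral (rectpath p r) (log_deriv \<omega>)"
    proof (rule contour_integral_cong[OF refl])
      fix z assume "z \<in> path_image (rectpath p r)"
      then have "z \<in> ?H" using im K by auto
      then show "deriv ?f z / ?f z = log_deriv \<omega> z" by (simp only: deriv log_deriv_def)
    qed
    moreover have cont: "continuous_on (cbox p r - box p r) (log_deriv \<omega>)"
    proof -
      have sub: "cbox p r - box p r \<subseteq> ?H" using K by auto
      show ?thesis
        unfolding log_deriv_def using bd
        by (intro continuous_on_divide holomorphic_on_imp_continuous_on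
            holomorphic_on_subset[OF holomorphic_dirichlet[OF s] sub]
            holomorphic_on_subset[OF holomorphic_dirichlet_dlog[OF s] sub])
    qed
    have le: "Re p \<le> Re r" "Im p \<le> Im r" using x y by (auto simp: p_def r_def)
    have eqs: "Complex (Re r) (Im p) = p'" "Complex (Re p) (Im r) = r'"
      by (simp_all add: p_def r_def p'_def r'_def)
    note R = contour_integral_rectpath_sides[OF le cont, unfolded eqs]
    have sd: "contour_integral (linepath u v) (log_deriv \<omega>) = side u v \<omega>"
      if "closed_segment u v \<subseteq> cbox p r - box p r" for u v
      unfolding side_def by (rule contour_integral_linepath_lborel[OF continuous_on_subset[OF cont that]])
    have "contour_integral (rectpath p r) (log_deriv \<omega>) = side p p' \<omega> + side p' r \<omega> - side r' r \<omega> - side p r' \<omega>"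
      unfolding R(1) by (simp only: sd R(2-))
    ultimately have "side p p' \<omega> + side p' r \<omega> - side r' r \<omega> - side p r' \<omega> = 2 * pi * \<i> * ?n"
      using cnt by simp
    with zc show ?case by blast
  qed
qed

text \<open>The count equals Re W almost everywhere, with W integrable; this carries its nonnegative
  integral over to the Bochner integral of the sides. Nonnegativity of Re W keeps
  \<open>ennreal\<close> from truncating.\<close>

lemma nn_integral_zero_count:
  assumes x: "1/2 < x1" "x1 < x2" and y: "y1 < y2"
  shows "(\<integral>\<^sup>+ \<omega>. zero_count (rand_dirichlet a \<omega>) (open_rect x1 x2 y1 y2) \<partial>M) =
    ennreal (1 / (2 * pi) * (deriv riemann_zeta (2 * x2) / riemann_zeta (2 * x2)
                             - deriv riemann_zeta (2 * x1) / riemann_zeta (2 * x1)) * (y2 - y1))"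
proof -
  let ?R = "\<lambda>x. deriv riemann_zeta (2 * x) / riemann_zeta (2 * x)"
  define p r p' r' where "p = Complex x1 y1" and "r = Complex x2 y2"
    and "p' = Complex x2 y1" and "r' = Complex x1 y2"
  define W where "W \<omega> = (side p p' \<omega> + side p' r \<omega> - side r' r \<omega> - side p r' \<omega>) / (2 * pi * \<i>)" for \<omega>
  have gt: "Re p > 1/2" "Re r > 1/2" "Re p' > 1/2" "Re r' > 1/2"
    using x by (auto simp: p_def r_def p'_def r'_def)
  note int = side_expectation(1)[OF gt(1,3)] side_expectation(1)[OF gt(3,2)]
    side_expectation(1)[OF gt(4,2)] side_expectation(1)[OF gt(1,4)]
  have Wint: "integrable M W"
    unfolding W_def[abs_def] using int
    by (intro integrable_divide Bochner_Integration.integrable_diff Bochner_Integration.integrable_add) auto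
  \<comment> \<open>The expected integrand depends on the real part only, and the two parallel sides
    have equal real parts at each parameter.\<close>
  have horizontal: "expectation (side p p') = expectation (side r' r)"
  proof -
    have "Re (linepath p p' t) = Re (linepath r' r t)" for t
      by (simp add: linepath_def p_def r_def p'_def r'_def)
    moreover have "p' - p = r - r'" by (simp add: p_def r_def p'_def r'_def complex_eq_iff)
    ultimately show ?thesis
      by (simp only: side_expectation(2)[OF gt(1,3)] side_expectation(2)[OF gt(4,2)])
  qed
  have "expectation W = (expectation (side p p') + expectation (side p' r) - expectation (side r' r) - expectation (side p r')) / (2 * pi * \<i>)"
    unfolding W_def[abs_def] using int
    by (simp add: Bochner_Integration.integral_diff Bochner_Integration.integral_add)
  also have "\<dots> = (of_real (?R x2) * (\<i> * of_real (y2 - y1)) - of_real (?R x1) * (\<i> * of_real (y2 - y1))) / (2 * pi * \<i>)"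
    using x side_expectation_vertical[of x2 y1 y2] side_expectation_vertical[of x1 y1 y2]
    unfolding horizontal by (simp add: p_def r_def p'_def r'_def)
  also have "\<dots> = of_real (1 / (2 * pi) * (?R x2 - ?R x1) * (y2 - y1))"
  proof -
    have "(of_real A * (\<i> * of_real d) - of_real B * (\<i> * of_real d)) / (2 * pi * \<i>) =
        complex_of_real (1 / (2 * pi) * (A - B) * d)" for A B d :: real
      by (simp add: field_simps)
    then show ?thesis .
  qed
  finally have EW: "expectation W = of_real (1 / (2 * pi) * (?R x2 - ?R x1) * (y2 - y1))" .
  have ae: "AE \<omega> in M. zero_count (rand_dirichlet a \<omega>) (open_rect x1 x2 y1 y2) = ennreal (Re (W \<omega>)) \<and> 0 \<le> Re (W \<omega>)"
    using AE_count_zeros[OF x y]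
  proof eventually_elim
    case (elim \<omega>)
    then obtain n :: nat where n: "zero_count (rand_dirichlet a \<omega>) (open_rect x1 x2 y1 y2) = of_nat n"
      "W \<omega> = 2 * pi * \<i> * of_nat n / (2 * pi * \<i>)"
      unfolding W_def p_def r_def p'_def r'_def by auto
    then have "W \<omega> = of_nat n" by simp
    then show ?case using n by (simp add: ennreal_of_nat_eq_real_of_nat)
  qed
  then have "(\<integral>\<^sup>+ \<omega>. zero_count (rand_dirichlet a \<omega>) (open_rect x1 x2 y1 y2) \<partial>M) = (\<integral>\<^sup>+ \<omega>. ennreal (Re (W \<omega>)) \<partial>M)"
    by (intro nn_integral_cong_AE) auto
  also have "\<dots> = ennreal (expectation (\<lambda>\<omega>. Re (W \<omega>)))"
    using Wint ae by (intro nn_integral_eq_integral integrable_Re) auto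
  also have "expectation (\<lambda>\<omega>. Re (W \<omega>)) = Re (expectation W)"
    using Wint by (rule integral_Re)
  finally show ?thesis unfolding EW Re_complex_of_real .
qed

end

theorem theorem8p3:
  fixes M :: "'a measure" and a :: "nat \<Rightarrow> 'a \<Rightarrow> complex" and \<sigma> :: real
  assumes "prob_space M"
    and "\<sigma> > 0"
    and "prob_space.indep_vars M (\<lambda>_. borel) a UNIV"
    and "\<And>k. complex_normal M \<sigma> (a k)"
  shows "(AE \<omega> in M. \<forall>z. Re z > 1/2 \<longrightarrow> summable (\<lambda>k. a k \<omega> / of_nat (Suc k) powr z))
    \<and> (\<forall>x1 x2 y1 y2. 1/2 < x1 \<and> x1 < x2 \<and> y1 < y2 \<longrightarrow>
        (\<integral>\<^sup>+ \<omega>. zero_count (rand_dirichlet a \<omega>) (open_rect x1 x2 y1 y2) \<partial>M)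
        = ennreal (1 / (2 * pi) * (deriv riemann_zeta (2 * x2) / riemann_zeta (2 * x2)
                                    - deriv riemann_zeta (2 * x1) / riemann_zeta (2 * x1))
                   * (y2 - y1)))
    \<and> (\<forall>x2 y1 y2. 1/2 < x2 \<and> y1 < y2 \<longrightarrow>
        ((\<lambda>x1. \<integral>\<^sup>+ \<omega>. zero_count (rand_dirichlet a \<omega>) (open_rect x1 x2 y1 y2) \<partial>M)
          \<longlongrightarrow> \<infinity>) (at_right (1/2)))"
proof (intro conjI allI impI)
  interpret iid_gauss M a \<sigma>
    by (rule iid_gauss.intro[OF assms(1) iid_gauss_axioms.intro[OF assms(2-4)]])
  show "AE \<omega> in M. \<forall>z. Re z > 1/2 \<longrightarrow> summable (\<lambda>k. a k \<omega> / of_nat (Suc k) powr z)"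
    using AE_sqrt_cancel
  proof eventually_elim
    case (elim \<omega>)
    show ?case using sums_summable[OF dirichlet_sums[OF elim]] by simp
  qed
  show formula: "(\<integral>\<^sup>+ \<omega>. zero_count (rand_dirichlet a \<omega>) (open_rect x1 x2 y1 y2) \<partial>M)
        = ennreal (1 / (2 * pi) * (deriv riemann_zeta (2 * x2) / riemann_zeta (2 * x2)
                                    - deriv riemann_zeta (2 * x1) / riemann_zeta (2 * x1))
                   * (y2 - y1))"
    if "1/2 < x1 \<and> x1 < x2 \<and> y1 < y2" for x1 x2 y1 y2
    using that by (intro nn_integral_zero_count) auto
  fix x2 y1 y2 :: real assume xy: "1/2 < x2 \<and> y1 < y2"
  let ?R = "\<lambda>x. deriv riemann_zeta (2 * x) / riemann_zeta (2 * x)"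
  \<comment> \<open>Only the term at x1 moves: 2 x1 tends to 1 from the right, where
    \<zeta>'/\<zeta> tends to minus infinity. The formula holds for x1 between 1/2 and x2, hence
    eventually.\<close>
  have "filterlim (\<lambda>x. 2 * x) (at_right 1) (at_right (1/2 :: real))"
    by (auto simp: filterlim_at eventually_at_right_field intro!: tendsto_eq_intros exI[of _ 1])
  then have "filterlim ?R at_bot (at_right (1/2))"
    by (rule filterlim_compose[OF filterlim_log_deriv_zeta])
  then have "filterlim (\<lambda>x1. ?R x2 + - ?R x1) at_top (at_right (1/2))"
    by (intro filterlim_tendsto_add_at_top[OF tendsto_const]) (simp only: filterlim_uminus_at_bot[symmetric])
  then have "filterlim (\<lambda>x1. ((y2 - y1) / (2 * pi)) * (?R x2 + - ?R x1)) at_top (at_right (1/2))"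
    using xy by (intro filterlim_tendsto_pos_mult_at_top[OF tendsto_const]) auto
  then have "filterlim (\<lambda>x1. 1 / (2 * pi) * (?R x2 - ?R x1) * (y2 - y1)) at_top (at_right (1/2))"
    by (simp add: mult_ac)
  then have "((\<lambda>x1. ennreal (1 / (2 * pi) * (?R x2 - ?R x1) * (y2 - y1))) \<longlongrightarrow> \<infinity>) (at_right (1/2))"
    by (simp only: ennreal_tendsto_top_eq_at_top infinity_ennreal_def)
  moreover have "\<forall>\<^sub>F x1 in at_right (1/2). x1 \<in> {1/2<..<x2}"
    using xy by (intro eventually_at_rightI[of "1/2" x2]) auto
  then have "\<forall>\<^sub>F x1 in at_right (1/2). ennreal (1 / (2 * pi) * (?R x2 - ?R x1) * (y2 - y1)) =
      (\<integral>\<^sup>+ \<omega>. zero_count (rand_dirichlet a \<omega>) (open_rect x1 x2 y1 y2) \<partial>M)"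
    by eventually_elim (use xy in \<open>simp add: formula\<close>)
  ultimately show "((\<lambda>x1. \<integral>\<^sup>+ \<omega>. zero_count (rand_dirichlet a \<omega>) (open_rect x1 x2 y1 y2) \<partial>M)
          \<longlongrightarrow> \<infinity>) (at_right (1/2))"
    by (rule Lim_transform_eventually)
qed

end
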